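(* Let $\mathcal{W}$ be a periodic labeled wedge of period $p$ and preperiod $q$, with associated graph $\Gamma$ and finite model $\Gamma_1=\Gamma/\equiv_{p,q}$. Then the set of roots in the open unit disk $\mathbb{D}$ of the spectral determinant $P_\Gamma$ equals the set of roots in $\mathbb{D}$ of the spectral determinant $P_{\Gamma_1}$.
   Context: $\Sigma=\{(i,j)\in\mathbb{N}^2:1\le i\le j\}$; a labeled wedge is $\Phi:\Sigma\to\{N,S,E\}$. Its graph $\Gamma$: vertices $\Sigma$; no edges out of $E$-vertices; $(i,j)\to(i+1,j+1)$ out of $N$-vertices; $(i,j)\to(1,i+1)$ and $(i,j)\to(1,j+1)$ out of $S$-vertices. For $p\ge1,q\ge0$: $i\equiv_{p,q}j$ iff $i=j$ or ($\min\{i,j\}\ge q+1$ and $i\equiv j\bmod p$); on $\Sigma$, $(i,j)\equiv_{p,q}(k,l)$ iff ($i\equiv_{p,q}k$, $j\equiv_{p,q}l$) or ($i\equiv_{p,q}l$, $j\equiv_{p,q}k$). $\mathcal{W}$ is periodic of period $p$ and preperiod $q$ if equivalent vertices have equal labels and $(i,j)$ is labeled $E$ iff $i\equiv_{p,q}j$. $\Gamma_1$ is the quotient graph: vertices are $\equiv_{p,q}$-classes and the number of edges $[v]\to[w]$ is the number of edges from $v$ to members of $[w]$. In a directed graph, a simple cycle is a closed path without self-intersection, up to cyclic permutation; a multicycle is a finite union (possibly empty) of simple cycles with pairwise disjoint vertex sets; its length $\ell(\gamma)$ is the total number of edges and $C(\gamma)$ its number of simple cycles. The spectral determinant is $P(t)=\sum_{\gamma}(-1)^{C(\gamma)}t^{\ell(\gamma)}$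 over all multicycles. For $\Gamma$ there are finitely many multicycles of each length and $P_\Gamma$ converges to a holomorphic function on $\mathbb{D}$; for the finite graph $\Gamma_1$, $P_{\Gamma_1}(t)=\det(I-tA)$ with $A$ its adjacency matrix. *)

theory Defs
  imports "HOL-Analysis.Analysis"
begin

datatype wlabel = N | S | E

definition wedge_dom :: "(nat \<times> nat) set" where
  "wedge_dom = {(i, j). 1 \<le> i \<and> i \<le> j}"

definition wedge_edges :: "(nat \<times> nat \<Rightarrow> wlabel) \<Rightarrow> ((nat \<times> nat) \<times> (nat \<times> nat)) set" where
  "wedge_edges Phi = {((i, j), w). (i, j) \<in> wedge_dom \<and>
      ((Phi (i, j) = N \<and> w = (i + 1, j + 1)) \<or>
       (Phi (i, j) = S \<and> (w = (1, i + 1) \<or> w = (1, j + 1))))}"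

text \<open>A simple cycle, represented by its (rotation-invariant) set of edges:
  a closed path through pairwise distinct vertices whose edges lie in Ed.\<close>
definition simple_cycle :: "('a \<times> 'a) set \<Rightarrow> ('a \<times> 'a) set \<Rightarrow> bool" where
  "simple_cycle Ed C \<longleftrightarrow>
     (\<exists>vs. vs \<noteq> [] \<and> distinct vs \<and>
        C = {(vs ! k, vs ! ((k + 1) mod length vs)) | k. k < length vs}) \<and> C \<subseteq> Ed"

definition multicycle :: "('a \<times> 'a) set \<Rightarrow> ('a \<times> 'a) set set \<Rightarrow> bool" where
  "multicycle Ed M \<longleftrightarrow> finite M \<and> (\<forall>C\<in>M. simple_cycle Ed C) \<and>
     (\<forall>C\<in>M. \<forall>D\<in>M. C \<noteq> D \<longrightarrow> fst ` C \<inter> fst ` D = {})"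

definition mc_length :: "('a \<times> 'a) set set \<Rightarrow> nat" where
  "mc_length M = (\<Sum>C\<in>M. card C)"

text \<open>n-th coefficient of the spectral determinant: sum of (-1)^C(gamma) over multicycles of length n
  (finitely many for the graphs considered).\<close>
definition spectral_coeff :: "('a \<times> 'a) set \<Rightarrow> nat \<Rightarrow> int" where
  "spectral_coeff Ed n = (\<Sum>M\<in>{M. multicycle Ed M \<and> mc_length M = n}. (-1) ^ card M)"

definition spectral_det :: "('a \<times> 'a) set \<Rightarrow> complex \<Rightarrow> complex" where
  "spectral_det Ed t = (\<Sum>n. of_int (spectral_coeff Ed n) * t ^ n)"

definition eqv_pq :: "nat \<Rightarrow> nat \<Rightarrow> nat \<Rightarrow> nat \<Rightarrow> bool" where
  "eqv_pq p q i j \<longleftrightarrow> i = j \<or> (min i j \<ge> q + 1 \<and> i mod p = j mod p)"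

definition eqv_pair :: "nat \<Rightarrow> nat \<Rightarrow> nat \<times> nat \<Rightarrow> nat \<times> nat \<Rightarrow> bool" where
  "eqv_pair p q v w \<longleftrightarrow>
     (eqv_pq p q (fst v) (fst w) \<and> eqv_pq p q (snd v) (snd w)) \<or>
     (eqv_pq p q (fst v) (snd w) \<and> eqv_pq p q (snd v) (fst w))"

definition periodic_wedge :: "(nat \<times> nat \<Rightarrow> wlabel) \<Rightarrow> nat \<Rightarrow> nat \<Rightarrow> bool" where
  "periodic_wedge Phi p q \<longleftrightarrow>
     (\<forall>v\<in>wedge_dom. \<forall>w\<in>wedge_dom. eqv_pair p q v w \<longrightarrow> Phi v = Phi w) \<and>
     (\<forall>i j. (i, j) \<in> wedge_dom \<longrightarrow> (Phi (i, j) = E \<longleftrightarrow> eqv_pq p q i j))"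

definition quot_verts :: "nat \<Rightarrow> nat \<Rightarrow> (nat \<times> nat) set set" where
  "quot_verts p q = wedge_dom // {(v, w). v \<in> wedge_dom \<and> w \<in> wedge_dom \<and> eqv_pair p q v w}"

definition quot_adj :: "(nat \<times> nat \<Rightarrow> wlabel) \<Rightarrow> (nat \<times> nat) set \<Rightarrow> (nat \<times> nat) set \<Rightarrow> nat" where
  "quot_adj Phi X Y = card {w \<in> Y. ((SOME v. v \<in> X), w) \<in> wedge_edges Phi}"

text \<open>Spectral determinant of Gamma_1: det(I - tA), written out via the Leibniz formula over the
  finite vertex set of Gamma_1.\<close>
definition quot_spectral_det :: "(nat \<times> nat \<Rightarrow> wlabel) \<Rightarrow> nat \<Rightarrow> nat \<Rightarrow> complex \<Rightarrow> complex" where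
  "quot_spectral_det Phi p q t =
     (\<Sum>\<sigma> | \<sigma> permutes quot_verts p q. of_int (sign \<sigma>) *
        (\<Prod>X\<in>quot_verts p q. (if \<sigma> X = X then 1 else 0) - t * of_nat (quot_adj Phi X (\<sigma> X))))"

end

theory Submission
  imports Defs
    "HOL-Complex_Analysis.Complex_Analysis"
    "HOL-Combinatorics.Cycles"
    "HOL-Number_Theory.Cong"
    "Jordan_Normal_Form.Determinant"
begin

text \<open>For \<open>n > q + p\<close> consider the finite graph \<open>W\<^sub>n\<close> on unordered pairs of coordinates in \<open>{1..n}\<close> in
  which the successor of \<open>n\<close> is \<open>n + 1 - p\<close>. Merging the coordinate \<open>n + 1\<close> of the next graph with
  \<open>n + 1 - p\<close> identifies only vertices with the same outgoing edges, and by \<open>det (I - AB) = det (I - BA)\<close>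
  this does not change \<open>det (I - tA)\<close>. So all \<open>W\<^sub>n\<close> have the spectral determinant of \<open>\<Gamma>\<^sub>1\<close>.

  In \<open>W\<^sub>n\<close> with \<open>n\<close> large, a short cycle has either no coordinate near \<open>n\<close>, and is then a cycle of \<open>\<Gamma>\<close>,
  or exactly one, or two. The cycles of the last two kinds live in fixed finite graphs in which every
  vertex has at most one outgoing edge. Letting \<open>n\<close> grow gives \<open>P(\<Gamma>\<^sub>1) = P(\<Gamma>) Q\<close> as formal power series,
  where \<open>Q\<close> is the product of the spectral determinants of these two graphs; it has no zeros in the open
  unit disk because \<open>I - tA\<close> is strictly diagonally dominant there. Hence \<open>P(\<Gamma>)\<close> is the expansion of
  the holomorphic function \<open>P(\<Gamma>\<^sub>1) / Q\<close>.\<close>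

section \<open>Determinants over finite index sets\<close>

text \<open>Determinants are indexed by arbitrary finite sets, since the vertices are pairs or
  classes of pairs; the shape is that of \<open>quot_spectral_det\<close>.\<close>

definition sdet :: "'a set \<Rightarrow> ('a \<Rightarrow> 'a \<Rightarrow> 'b :: comm_ring_1) \<Rightarrow> 'b" where
  "sdet V A = (\<Sum>\<sigma> | \<sigma> permutes V. of_int (sign \<sigma>) * (\<Prod>x\<in>V. A x (\<sigma> x)))"

lemma sdet_cong:
  assumes "\<And>x y. x \<in> V \<Longrightarrow> y \<in> V \<Longrightarrow> A x y = B x y"
  shows "sdet V A = sdet V B"
  unfolding sdet_def
  by (intro sum.cong refl arg_cong2[of _ _ _ _ "(*)"] prod.cong)
     (auto simp: assms permutes_in_image)

text \<open>Transporting permutations along \<open>f\<close> is a bijection that preserves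
  signs.\<close>

lemma sdet_reindex:
  assumes f: "bij_betw f V W" and "finite V"
  shows "sdet W A = sdet V (\<lambda>x y. A (f x) (f y))"
proof -
  have inj: "inj_on f V" and W: "W = f ` V" using f by (auto simp: bij_betw_def)
  have bij: "bij_betw (map_permutation V f) {\<sigma>. \<sigma> permutes V} {\<sigma>. \<sigma> permutes W}"
  proof (rule bij_betwI[where g = "map_permutation W (inv_into V f)"])
    show "map_permutation V f \<in> {\<sigma>. \<sigma> permutes V} \<rightarrow> {\<sigma>. \<sigma> permutes W}"
      using map_permutation_permutes[OF f] by auto
    show "map_permutation W (inv_into V f) \<in> {\<sigma>. \<sigma> permutes W} \<rightarrow> {\<sigma>. \<sigma> permutes V}"
      using map_permutation_permutes[OF bij_betw_inv_into[OF f]] by auto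
    show "map_permutation W (inv_into V f) (map_permutation V f \<sigma>) = \<sigma>"
      if "\<sigma> \<in> {\<sigma>. \<sigma> permutes V}" for \<sigma>
      by (rule map_permutation_compose_inv) (use that f inj in auto)
    show "map_permutation V f (map_permutation W (inv_into V f) \<sigma>) = \<sigma>"
      if "\<sigma> \<in> {\<sigma>. \<sigma> permutes W}" for \<sigma>
      by (rule map_permutation_compose_inv)
         (use that bij_betw_inv_into[OF f] f_inv_into_f[of _ f V] W in auto)
  qed
  have "sdet W A = (\<Sum>\<sigma> | \<sigma> permutes V. of_int (sign (map_permutation V f \<sigma>)) *
                      (\<Prod>x\<in>W. A x (map_permutation V f \<sigma> x)))"
    unfolding sdet_def by (rule sum.reindex_bij_betw[OF bij, symmetric])
  also have "\<dots> = sdet V (\<lambda>x y. A (f x) (f y))"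
    unfolding sdet_def
  proof (rule sum.cong[OF refl])
    fix \<sigma> assume "\<sigma> \<in> {\<sigma>. \<sigma> permutes V}"
    then have \<sigma>: "\<sigma> permutes V" by simp
    have "(\<Prod>x\<in>W. A x (map_permutation V f \<sigma> x)) = (\<Prod>x\<in>V. A (f x) (f (\<sigma> x)))"
      unfolding W using inj by (subst prod.reindex) (auto simp: map_permutation_apply)
    then show "of_int (sign (map_permutation V f \<sigma>)) * (\<Prod>x\<in>W. A x (map_permutation V f \<sigma> x)) =
          of_int (sign \<sigma>) * (\<Prod>x\<in>V. A (f x) (f (\<sigma> x)))"
      by (simp add: sign_map_permutation[OF inj \<sigma> \<open>finite V\<close>])
  qed
  finally show ?thesis .
qed

text \<open>Numbering the vertices gives access to block matrices and kernel vectors.\<close>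

lemma sdet_eq_det:
  assumes "bij_betw f {0..<n} V"
  shows "sdet V A = det (mat n n (\<lambda>(i, j). A (f i) (f j)))"
proof -
  have "sdet V A = sdet {0..<n} (\<lambda>i j. A (f i) (f j))"
    by (rule sdet_reindex[OF assms]) simp
  also have "\<dots> = det (mat n n (\<lambda>(i, j). A (f i) (f j)))"
    unfolding sdet_def det_def
    by (auto intro!: sum.cong prod.cong simp: permutes_in_image[of _ "{0..<n}", simplified])
  finally show ?thesis .
qed

text \<open>Listing \<open>V\<close> before \<open>W\<close> makes the matrix block upper
  triangular.\<close>

lemma sdet_union:
  fixes A :: "'a \<Rightarrow> 'a \<Rightarrow> 'b :: idom"
  assumes "finite V" "finite W" "V \<inter> W = {}"
    and zero: "\<And>x y. x \<in> W \<Longrightarrow> y \<in> V \<Longrightarrow> A x y = 0"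
  shows "sdet (V \<union> W) A = sdet V A * sdet W A"
proof -
  obtain f n where f: "bij_betw f {0..<n::nat} V"
    using ex_bij_betw_nat_finite[OF \<open>finite V\<close>] by blast
  obtain g m where g: "bij_betw g {0..<m::nat} W"
    using ex_bij_betw_nat_finite[OF \<open>finite W\<close>] by blast
  define h where "h = (\<lambda>i. if i < n then f i else g (i - n))"
  have "bij_betw h ({0..<n} \<union> {n..<n+m}) (V \<union> W)"
  proof (rule bij_betw_combine)
    show "bij_betw h {0..<n} V"
      by (rule bij_betw_cong[THEN iffD1, OF _ f]) (auto simp: h_def)
    have "bij_betw (\<lambda>i. i - n) {n..<n+m} {0..<m}"
      by (rule bij_betwI[where g = "\<lambda>i. i + n"]) auto
    from bij_betw_trans[OF this g] show "bij_betw h {n..<n+m} W"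
      by (rule bij_betw_cong[THEN iffD1, rotated]) (auto simp: h_def)
  qed fact
  then have h: "bij_betw h {0..<n+m} (V \<union> W)"
    by (simp add: ivl_disj_un)
  let ?B = "\<lambda>f g n m. mat n m (\<lambda>(i, j). A (f i) (g j))"
  have fV: "f i \<in> V" if "i < n" for i using f that by (auto dest: bij_betwE)
  have gW: "g i \<in> W" if "i < m" for i using g that by (auto dest: bij_betwE)
  have "?B h h (n+m) (n+m) = four_block_mat (?B f f n n) (?B f g n m) (0\<^sub>m m n) (?B g g m m)"
    by (rule eq_matI) (auto simp: h_def zero fV gW)
  then show ?thesis
    by (simp add: sdet_eq_det[OF f] sdet_eq_det[OF g] sdet_eq_det[OF h]
        det_four_block_mat_lower_left_zero[OF _ _ refl])
qed

text \<open>Multiply \<open>?M\<close> = [[1, A], [B, 1]] by the unipotent \<open>?L\<close> =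
  [[1, 0], [-B, 1]] on either side: the products are block triangular with diagonal blocks 1 - AB, 1
  and 1, 1 - BA, and \<open>?L\<close> has determinant 1.\<close>

lemma det_one_minus_mult_commute:
  fixes A :: "'b :: idom mat"
  assumes A: "A \<in> carrier_mat n m" and B: "B \<in> carrier_mat m n"
  shows "det (1\<^sub>m n - A * B) = det (1\<^sub>m m - B * A)"
proof -
  have AB: "A * B \<in> carrier_mat n n" and BA: "B * A \<in> carrier_mat m m" using A B by auto
  have mA: "- A \<in> carrier_mat n m" and mB: "- B \<in> carrier_mat m n" using A B by auto
  let ?M = "four_block_mat (1\<^sub>m n) A B (1\<^sub>m m)"
  let ?L = "four_block_mat (1\<^sub>m n) (0\<^sub>m n m) (- B) (1\<^sub>m m)"
  have M: "?M \<in> carrier_mat (n + m) (n + m)" and L: "?L \<in> carrier_mat (n + m) (n + m)" by auto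
  have dL: "det ?L = 1"
    by (subst det_four_block_mat_upper_right_zero[OF _ refl mB]) auto
  have "?M * ?L = four_block_mat (1\<^sub>m n * 1\<^sub>m n + A * (- B)) (1\<^sub>m n * 0\<^sub>m n m + A * 1\<^sub>m m)
           (B * 1\<^sub>m n + 1\<^sub>m m * (- B)) (B * 0\<^sub>m n m + 1\<^sub>m m * 1\<^sub>m m)"
    by (rule mult_four_block_mat[OF _ A B _ _ _ mB]) auto
  also have "1\<^sub>m n * 1\<^sub>m n + A * (- B) = 1\<^sub>m n - A * B"
    using A B by (intro eq_matI) (auto simp: scalar_prod_uminus_right)
  also have "B * 1\<^sub>m n + 1\<^sub>m m * (- B) = 0\<^sub>m m n"
    using B by (intro eq_matI) (auto simp: right_mult_one_mat[OF B] left_mult_one_mat[OF mB])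
  also have "1\<^sub>m n * 0\<^sub>m n m + A * 1\<^sub>m m = A" using A by auto
  also have "B * 0\<^sub>m n m + 1\<^sub>m m * 1\<^sub>m m = 1\<^sub>m m" using B by auto
  finally have "det (?M * ?L) = det (1\<^sub>m n - A * B)"
    using AB A by (simp add: det_four_block_mat_lower_left_zero[OF minus_carrier_mat[OF AB] A refl one_carrier_mat])
  then have 1: "det ?M = det (1\<^sub>m n - A * B)"
    using det_mult[OF M L] dL by simp
  have "?L * ?M = four_block_mat (1\<^sub>m n * 1\<^sub>m n + 0\<^sub>m n m * B) (1\<^sub>m n * A + 0\<^sub>m n m * 1\<^sub>m m)
           ((- B) * 1\<^sub>m n + 1\<^sub>m m * B) ((- B) * A + 1\<^sub>m m * 1\<^sub>m m)"
    by (rule mult_four_block_mat[OF _ _ mB _ _ A B]) auto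
  also have "(- B) * A + 1\<^sub>m m * 1\<^sub>m m = 1\<^sub>m m - B * A"
    using A B by (intro eq_matI) (auto simp: scalar_prod_uminus_left)
  also have "(- B) * 1\<^sub>m n + 1\<^sub>m m * B = 0\<^sub>m m n"
    using B by (intro eq_matI) (auto simp: right_mult_one_mat[OF mB] left_mult_one_mat[OF B])
  also have "1\<^sub>m n * A + 0\<^sub>m n m * 1\<^sub>m m = A" using A by auto
  also have "1\<^sub>m n * 1\<^sub>m n + 0\<^sub>m n m * B = 1\<^sub>m n" using B by auto
  finally have "det (?L * ?M) = det (1\<^sub>m m - B * A)"
    using BA A by (simp add: det_four_block_mat_lower_left_zero[OF one_carrier_mat A refl minus_carrier_mat[OF BA]])
  then have 2: "det ?M = det (1\<^sub>m m - B * A)"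
    using det_mult[OF L M] dL by simp
  show ?thesis using 1 2 by simp
qed

lemma sdet_one_minus_mult_commute:
  fixes A :: "'a \<Rightarrow> 'c \<Rightarrow> 'b :: idom"
  assumes "finite V" "finite W"
  shows "sdet V (\<lambda>x y. (if x = y then 1 else 0) - (\<Sum>w\<in>W. A x w * B w y)) =
         sdet W (\<lambda>x y. (if x = y then 1 else 0) - (\<Sum>v\<in>V. B x v * A v y))"
proof -
  obtain f n where f: "bij_betw f {0..<n::nat} V"
    using ex_bij_betw_nat_finite[OF \<open>finite V\<close>] by blast
  obtain g m where g: "bij_betw g {0..<m::nat} W"
    using ex_bij_betw_nat_finite[OF \<open>finite W\<close>] by blast
  define P where "P = mat n m (\<lambda>(i, j). A (f i) (g j))"
  define Q where "Q = mat m n (\<lambda>(i, j). B (g i) (f j))"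
  have PQ: "P \<in> carrier_mat n m" "Q \<in> carrier_mat m n" by (auto simp: P_def Q_def)
  have f_eq: "f i = f j \<longleftrightarrow> i = j" if "i < n" "j < n" for i j
    using f that by (auto simp: bij_betw_def inj_on_def)
  have g_eq: "g i = g j \<longleftrightarrow> i = j" if "i < m" "j < m" for i j
    using g that by (auto simp: bij_betw_def inj_on_def)
  have "sdet V (\<lambda>x y. (if x = y then 1 else 0) - (\<Sum>w\<in>W. A x w * B w y)) = det (1\<^sub>m n - P * Q)"
    unfolding sdet_eq_det[OF f]
    by (intro arg_cong[of _ _ det] eq_matI)
       (auto simp: P_def Q_def scalar_prod_def f_eq sum.reindex_bij_betw[OF g, symmetric])
  also have "\<dots> = det (1\<^sub>m m - Q * P)" by (rule det_one_minus_mult_commute[OF PQ])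
  also have "\<dots> = sdet W (\<lambda>x y. (if x = y then 1 else 0) - (\<Sum>v\<in>V. B x v * A v y))"
    unfolding sdet_eq_det[OF g]
    by (intro arg_cong[of _ _ det] eq_matI)
       (auto simp: P_def Q_def scalar_prod_def g_eq sum.reindex_bij_betw[OF f, symmetric])
  finally show ?thesis .
qed

text \<open>The parameter ranges over any commutative ring: at \<open>fps_X\<close> the determinant
  is a formal power series, at a complex number its value. A relation has no parallel edges, so
  quotients with double edges need \<open>sdet\<close> directly.\<close>

definition rel_det :: "'a set \<Rightarrow> ('a \<times> 'a) set \<Rightarrow> 'b :: comm_ring_1 \<Rightarrow> 'b" where
  "rel_det V R t = sdet V (\<lambda>x y. (if x = y then 1 else 0) - t * (if (x, y) \<in> R then 1 else 0))"

text \<open>Vertices with the same out-neighbours can be merged: with the 0/1 matrix \<open>P\<close> of \<open>\<pi>\<close> and the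
  rows \<open>A\<close> of \<open>R\<close> at the representatives, the two adjacency matrices are \<open>P A\<close> and \<open>A P\<close>.\<close>
lemma rel_det_merge_multi:
  fixes t :: "'b :: idom"
  assumes "finite V" "W \<subseteq> V" and R: "R \<subseteq> V \<times> V"
    and \<pi>: "\<And>x. x \<in> V \<Longrightarrow> \<pi> x \<in> W"
    and twin: "\<And>x. x \<in> V \<Longrightarrow> R `` {x} = R `` {\<pi> x}"
  shows "rel_det V R t =
    sdet W (\<lambda>x y. (if x = y then 1 else 0) - t * of_nat (card {v \<in> R `` {x}. \<pi> v = y}))"
proof -
  have "finite W" using assms finite_subset by blast
  have eq1: "(\<Sum>w\<in>W. (t * of_bool (\<pi> x = w)) * of_bool ((w, y) \<in> R)) =
            t * (if (x, y) \<in> R then 1 else 0)" if "x \<in> V" for x y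
  proof -
    have "(\<Sum>w\<in>W. (t * of_bool (\<pi> x = w)) * of_bool ((w, y) \<in> R)) =
          (\<Sum>w\<in>W. if \<pi> x = w then t * of_bool ((w, y) \<in> R) else 0)"
      by (intro sum.cong) auto
    also have "\<dots> = t * of_bool ((\<pi> x, y) \<in> R)"
      using \<pi>[OF that] \<open>finite W\<close> by (simp add: sum.delta')
    also have "(\<pi> x, y) \<in> R \<longleftrightarrow> (x, y) \<in> R" using twin[OF that] by auto
    finally show ?thesis by simp
  qed
  have eq2: "(\<Sum>v\<in>V. of_bool ((x, v) \<in> R) * (t * of_bool (\<pi> v = y))) =
            t * of_nat (card {v \<in> R `` {x}. \<pi> v = y})" for x y
  proof -
    have "(\<Sum>v\<in>V. of_bool ((x, v) \<in> R) * (t * of_bool (\<pi> v = y))) =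
          (\<Sum>v\<in>V. if (x, v) \<in> R \<and> \<pi> v = y then t else 0)"
      by (intro sum.cong) auto
    also have "\<dots> = of_nat (card (V \<inter> {v. (x, v) \<in> R \<and> \<pi> v = y})) * t"
      by (simp add: sum.If_cases[OF \<open>finite V\<close>])
    also have "V \<inter> {v. (x, v) \<in> R \<and> \<pi> v = y} = {v \<in> R `` {x}. \<pi> v = y}" using R by auto
    finally show ?thesis by (simp add: mult.commute)
  qed
  show ?thesis
    unfolding rel_det_def
    using sdet_one_minus_mult_commute[OF \<open>finite V\<close> \<open>finite W\<close>,
        of "\<lambda>x w. t * of_bool (\<pi> x = w)" "\<lambda>w y. of_bool ((w, y) \<in> R)"]
    by (simp add: eq1 eq2 cong: sdet_cong)
qed

text \<open>Injectivity of \<open>\<pi>\<close> on out-neighbourhoods means that merging creates no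
  parallel edges, so every multiplicity in \<open>rel_det_merge_multi\<close> is 0 or 1 and the
  result is again the determinant of a relation.\<close>

lemma rel_det_merge:
  fixes t :: "'b :: idom"
  assumes "finite V" "W \<subseteq> V" and R: "R \<subseteq> V \<times> V"
    and \<pi>: "\<And>x. x \<in> V \<Longrightarrow> \<pi> x \<in> W"
    and twin: "\<And>x. x \<in> V \<Longrightarrow> R `` {x} = R `` {\<pi> x}"
    and inj: "\<And>x. x \<in> W \<Longrightarrow> inj_on \<pi> (R `` {x})"
    and Q: "\<And>x. x \<in> W \<Longrightarrow> Q `` {x} = \<pi> ` (R `` {x})"
  shows "rel_det V R t = rel_det W Q t"
proof -
  have "of_nat (card {v \<in> R `` {x}. \<pi> v = y}) = (if (x, y) \<in> Q then 1 else (0 :: 'b))"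
    if "x \<in> W" for x y
  proof (cases "y \<in> \<pi> ` (R `` {x})")
    case True
    then obtain v where "v \<in> R `` {x}" "y = \<pi> v" by blast
    then have "{v \<in> R `` {x}. \<pi> v = y} = {v}" using inj[OF that] by (auto dest: inj_onD)
    then show ?thesis using True Q[OF that] by auto
  next
    case False
    then have "{v \<in> R `` {x}. \<pi> v = y} = {}" by auto
    then show ?thesis unfolding \<open>_ = {}\<close> using False Q[OF that] by auto
  qed
  then have "sdet W (\<lambda>x y. (if x = y then 1 else 0) - t * of_nat (card {v \<in> R `` {x}. \<pi> v = y})) =
      rel_det W Q t"
    unfolding rel_det_def by (intro sdet_cong) simp
  then show ?thesis
    using rel_det_merge_multi[OF assms(1-4) twin, of t] by simp
qed

text \<open>Each row of the adjacency matrix has at most one entry 1. At a coordinate of maximal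
  modulus, a kernel vector v of I - tA would satisfy |v_i| \<le> |t| |v_i|, which is impossible for
  |t| < 1 and nonzero v_i.\<close>

lemma rel_det_nonzero:
  fixes t :: complex
  assumes "finite V" and R: "R \<subseteq> V \<times> V" "single_valued R" and t: "norm t < 1"
  shows "rel_det V R t \<noteq> 0"
proof
  obtain f n where f: "bij_betw f {0..<n::nat} V"
    using ex_bij_betw_nat_finite[OF \<open>finite V\<close>] by blast
  have f_eq: "f i = f j \<longleftrightarrow> i = j" if "i < n" "j < n" for i j
    using f that by (auto simp: bij_betw_def inj_on_def)
  define A where "A = mat n n (\<lambda>(i, j). (if f i = f j then 1 else 0) -
      t * (if (f i, f j) \<in> R then 1 else 0))"
  have A: "A \<in> carrier_mat n n" by (simp add: A_def)
  assume "rel_det V R t = 0"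
  then have "det A = 0" unfolding rel_det_def sdet_eq_det[OF f] A_def by simp
  then obtain v where v: "v \<in> carrier_vec n" "v \<noteq> 0\<^sub>v n" "A *\<^sub>v v = 0\<^sub>v n"
    using det_0_iff_vec_prod_zero_field[OF A] by blast
  then have n: "n > 0" by (cases n) auto
  define m where "m = Max ((\<lambda>i. norm (v $ i)) ` {0..<n})"
  have le: "norm (v $ i) \<le> m" if "i < n" for i
    unfolding m_def using that by (intro Max_ge) auto
  have "m \<in> (\<lambda>i. norm (v $ i)) ` {0..<n}"
    unfolding m_def using n by (intro Max_in) auto
  then obtain i where i: "i < n" "norm (v $ i) = m" by auto
  have "m \<noteq> 0"
  proof
    assume "m = 0"
    then have "v $ j = 0" if "j < n" for j using le[OF that] by simp
    then have "v = 0\<^sub>v n" using v(1) by (intro eq_vecI) auto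
    then show False using v(2) by simp
  qed
  have "m \<ge> 0" using i by (metis norm_ge_zero)
  have "0 = (A *\<^sub>v v) $ i" using v i by simp
  also have "\<dots> = (\<Sum>j<n. ((if i = j then 1 else 0) - t * (if (f i, f j) \<in> R then 1 else 0)) * v $ j)"
    using i v(1) by (auto simp: A_def scalar_prod_def f_eq lessThan_atLeast0 intro!: sum.cong)
  also have "\<dots> = (\<Sum>j<n. (if i = j then v $ j else 0) - t * (if (f i, f j) \<in> R then v $ j else 0))"
    by (intro sum.cong) (auto simp: algebra_simps)
  also have "\<dots> = v $ i - t * (\<Sum>j<n. if (f i, f j) \<in> R then v $ j else 0)"
    using i by (simp add: sum_subtractf sum_distrib_left)
  finally have vi: "v $ i = t * (\<Sum>j<n. if (f i, f j) \<in> R then v $ j else 0)" by simp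
  have "norm (\<Sum>j<n. if (f i, f j) \<in> R then v $ j else 0) \<le> m"
  proof (cases "\<exists>j<n. (f i, f j) \<in> R")
    case True
    then obtain j where j: "j < n" "(f i, f j) \<in> R" by blast
    have "(f i, f k) \<in> R \<longleftrightarrow> k = j" if "k < n" for k
      using j that R(2) f_eq[OF that j(1)] by (auto dest: single_valuedD)
    then have "(\<Sum>j<n. if (f i, f j) \<in> R then v $ j else 0) = (\<Sum>k<n. if k = j then v $ k else 0)"
      by (intro sum.cong) auto
    then show ?thesis using j le by simp
  next
    case False
    then show ?thesis using \<open>m \<ge> 0\<close> by (auto simp: sum.neutral)
  qed
  then have "m \<le> norm t * m"
    using i vi \<open>m \<ge> 0\<close> by (metis norm_mult mult_left_mono norm_ge_zero)
  moreover have "norm t * m < 1 * m"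
    using t \<open>m \<noteq> 0\<close> \<open>m \<ge> 0\<close> by (intro mult_strict_right_mono) auto
  ultimately show False by simp
qed

section \<open>Multicycles as permutations\<close>

text \<open>A multicycle of length \<open>k\<close> amounts to a set \<open>X\<close> of \<open>k\<close> vertices together with a permutation
  of \<open>X\<close> that moves along edges.\<close>
definition covers :: "('a \<times> 'a) set \<Rightarrow> nat \<Rightarrow> ('a set \<times> ('a \<Rightarrow> 'a)) set" where
  "covers R k = {(X, \<sigma>). finite X \<and> card X = k \<and> \<sigma> permutes X \<and> (\<forall>x\<in>X. (x, \<sigma> x) \<in> R)}"

definition cover_coeff :: "('a \<times> 'a) set \<Rightarrow> nat \<Rightarrow> int" where
  "cover_coeff R k = (\<Sum>(X, \<sigma>)\<in>covers R k. (-1) ^ k * sign \<sigma>)"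

text \<open>\<open>X\<close> is the set of rows where the factor from -tA is chosen; in all other
  rows the factor is an entry of the identity, so only permutations that fix everything outside
  \<open>X\<close> and follow edges on \<open>X\<close> contribute.\<close>

lemma sum_permutes_fixing:
  fixes t :: "'b :: comm_ring_1"
  assumes "finite V" "X \<subseteq> V"
  shows "(\<Sum>\<sigma> | \<sigma> permutes V. of_int (sign \<sigma>) *
            ((\<Prod>x\<in>X. - (t * (if (x, \<sigma> x) \<in> R then 1 else 0))) * (\<Prod>x\<in>V - X. if x = \<sigma> x then 1 else 0))) =
         (\<Sum>\<sigma> | \<sigma> permutes X \<and> (\<forall>x\<in>X. (x, \<sigma> x) \<in> R). of_int ((-1) ^ card X * sign \<sigma>) * t ^ card X)"
proof (rule sum.mono_neutral_cong_right)
  have "finite X" using assms finite_subset by blast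
  show "finite {\<sigma>. \<sigma> permutes V}" using assms by (rule_tac finite_permutations)
  show "{\<sigma>. \<sigma> permutes X \<and> (\<forall>x\<in>X. (x, \<sigma> x) \<in> R)} \<subseteq> {\<sigma>. \<sigma> permutes V}"
    using assms(2) permutes_subset by blast
  show "\<forall>\<sigma>\<in>{\<sigma>. \<sigma> permutes V} - {\<sigma>. \<sigma> permutes X \<and> (\<forall>x\<in>X. (x, \<sigma> x) \<in> R)}.
      of_int (sign \<sigma>) * ((\<Prod>x\<in>X. - (t * (if (x, \<sigma> x) \<in> R then 1 else 0))) *
        (\<Prod>x\<in>V - X. if x = \<sigma> x then 1 else 0)) = 0"
  proof
    fix \<sigma> assume \<sigma>: "\<sigma> \<in> {\<sigma>. \<sigma> permutes V} - {\<sigma>. \<sigma> permutes X \<and> (\<forall>x\<in>X. (x, \<sigma> x) \<in> R)}"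
    show "of_int (sign \<sigma>) * ((\<Prod>x\<in>X. - (t * (if (x, \<sigma> x) \<in> R then 1 else 0))) *
        (\<Prod>x\<in>V - X. if x = \<sigma> x then 1 else 0)) = 0"
    proof (cases "\<forall>x\<in>V - X. \<sigma> x = x")
      case True
      then have "\<sigma> permutes X"
        using \<sigma> permutes_superset[of \<sigma> V X] by auto
      then obtain x where "x \<in> X" "(x, \<sigma> x) \<notin> R" using \<sigma> by blast
      then have "(\<Prod>x\<in>X. - (t * (if (x, \<sigma> x) \<in> R then 1 else 0))) = 0"
        using \<open>finite X\<close> by (intro prod_zero) auto
      then show ?thesis by simp
    next
      case False
      then obtain x where "x \<in> V - X" "x \<noteq> \<sigma> x" by metis
      then have "(\<Prod>x\<in>V - X. if x = \<sigma> x then 1 else 0 :: 'b) = 0"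
        using \<open>finite V\<close> by (intro prod_zero) auto
      then show ?thesis by simp
    qed
  qed
  fix \<sigma> assume \<sigma>: "\<sigma> \<in> {\<sigma>. \<sigma> permutes X \<and> (\<forall>x\<in>X. (x, \<sigma> x) \<in> R)}"
  then have "(\<Prod>x\<in>V - X. if x = \<sigma> x then 1 else 0 :: 'b) = 1"
    by (intro prod.neutral) (auto simp: permutes_not_in[of \<sigma> X])
  moreover have "(\<Prod>x\<in>X. - (t * (if (x, \<sigma> x) \<in> R then 1 else 0))) = (\<Prod>x\<in>X. - t)"
    using \<sigma> by (intro prod.cong) auto
  then have "(\<Prod>x\<in>X. - (t * (if (x, \<sigma> x) \<in> R then 1 else 0))) = (-1) ^ card X * t ^ card X"
    by (simp add: power_minus[of t])
  ultimately show "of_int (sign \<sigma>) * ((\<Prod>x\<in>X. - (t * (if (x, \<sigma> x) \<in> R then 1 else 0))) *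
        (\<Prod>x\<in>V - X. if x = \<sigma> x then 1 else 0)) = of_int ((-1) ^ card X * sign \<sigma>) * t ^ card X"
    by (simp add: algebra_simps)
qed

text \<open>Distribute the product over the sum of I and -tA, exchange the sums over \<sigma> and
  \<open>X\<close>, and collect the surviving pairs by the size of \<open>X\<close>.\<close>

lemma rel_det_expand:
  fixes t :: "'b :: comm_ring_1"
  assumes "finite V" and R: "R \<subseteq> V \<times> V"
  shows "rel_det V R t = (\<Sum>k\<le>card V. of_int (cover_coeff R k) * t ^ k)"
proof -
  define cov where "cov = (SIGMA X:Pow V. {\<sigma>. \<sigma> permutes X \<and> (\<forall>x\<in>X. (x, \<sigma> x) \<in> R)})"
  have finX: "finite X" if "X \<subseteq> V" for X
    using that \<open>finite V\<close> by (rule finite_subset)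
  have fin: "finite {\<sigma>. \<sigma> permutes X \<and> (\<forall>x\<in>X. (x, \<sigma> x) \<in> R)}" if "X \<subseteq> V" for X
    by (rule finite_subset[OF _ finite_permutations[OF finX[OF that]]]) blast
  have "finite cov"
    unfolding cov_def using fin \<open>finite V\<close> by (intro finite_SigmaI) simp_all
  have covers: "covers R k = {c \<in> cov. card (fst c) = k}" for k
  proof -
    have "X \<subseteq> V" if "\<forall>x\<in>X. (x, \<sigma> x) \<in> R" for X \<sigma> using that R by blast
    then have "(X, \<sigma>) \<in> covers R k \<longleftrightarrow> (X, \<sigma>) \<in> {c \<in> cov. card (fst c) = k}" for X \<sigma>
      unfolding covers_def cov_def using finX[of X] by auto
    then show ?thesis by auto
  qed
  have "rel_det V R t = (\<Sum>\<sigma> | \<sigma> permutes V. of_int (sign \<sigma>) *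
      (\<Prod>x\<in>V. - (t * (if (x, \<sigma> x) \<in> R then 1 else 0)) + (if x = \<sigma> x then 1 else 0)))"
    unfolding rel_det_def sdet_def by simp
  also have "\<dots> = (\<Sum>\<sigma> | \<sigma> permutes V. \<Sum>X\<in>Pow V. of_int (sign \<sigma>) *
      ((\<Prod>x\<in>X. - (t * (if (x, \<sigma> x) \<in> R then 1 else 0))) * (\<Prod>x\<in>V - X. if x = \<sigma> x then 1 else 0)))"
    by (simp only: prod_add[OF \<open>finite V\<close>] sum_distrib_left)
  also have "\<dots> = (\<Sum>X\<in>Pow V. \<Sum>\<sigma> | \<sigma> permutes V. of_int (sign \<sigma>) *
      ((\<Prod>x\<in>X. - (t * (if (x, \<sigma> x) \<in> R then 1 else 0))) * (\<Prod>x\<in>V - X. if x = \<sigma> x then 1 else 0)))"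
    by (rule sum.swap)
  also have "\<dots> = (\<Sum>X\<in>Pow V. \<Sum>\<sigma> | \<sigma> permutes X \<and> (\<forall>x\<in>X. (x, \<sigma> x) \<in> R).
      of_int ((-1) ^ card X * sign \<sigma>) * t ^ card X)"
    by (rule sum.cong[OF refl]) (rule sum_permutes_fixing[OF \<open>finite V\<close>], simp)
  also have "\<dots> = (\<Sum>(X, \<sigma>)\<in>cov. of_int ((-1) ^ card X * sign \<sigma>) * t ^ card X)"
    unfolding cov_def using \<open>finite V\<close> fin by (intro sum.Sigma) auto
  also have "\<dots> = (\<Sum>k\<le>card V. \<Sum>c\<in>{c \<in> cov. card (fst c) = k}.
      case c of (X, \<sigma>) \<Rightarrow> of_int ((-1) ^ card X * sign \<sigma>) * t ^ card X)"
    using \<open>finite cov\<close> \<open>finite V\<close>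
    by (intro sum.group[symmetric]) (auto simp: cov_def intro: card_mono)
  also have "\<dots> = (\<Sum>k\<le>card V. of_int (cover_coeff R k) * t ^ k)"
    unfolding cover_coeff_def covers[symmetric]
    by (intro sum.cong refl)
       (auto simp: sum_distrib_right covers_def split_def intro!: sum.cong)
  finally show ?thesis .
qed

lemma cover_coeff_eq_0:
  assumes "finite V" "R \<subseteq> V \<times> V" "k > card V"
  shows "cover_coeff R k = 0"
proof -
  have "covers R k = {}"
    using assms card_mono[OF assms(1)] by (fastforce simp: covers_def)
  then show ?thesis by (simp add: cover_coeff_def)
qed

lemma rel_det_fps_X:
  assumes "finite V" "R \<subseteq> V \<times> V"
  shows "rel_det V R fps_X = Abs_fps (\<lambda>k. of_int (cover_coeff R k) :: 'b :: comm_ring_1)"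
proof (rule fps_ext)
  fix n
  have "rel_det V R fps_X $ n =
      (\<Sum>k\<le>card V. (of_int (cover_coeff R k) * fps_X ^ k :: 'b fps) $ n)"
    unfolding rel_det_expand[OF assms] by (simp add: fps_sum_nth)
  also have "\<dots> = (\<Sum>k\<le>card V. if n = k then of_int (cover_coeff R k) else 0)"
    by (intro sum.cong refl) (simp flip: fps_of_int add: fps_X_power_mult_right_nth)
  also have "\<dots> = of_int (cover_coeff R n)"
    using cover_coeff_eq_0[OF assms, of n] by (auto simp: sum.delta)
  finally show "rel_det V R fps_X $ n = Abs_fps (\<lambda>k. of_int (cover_coeff R k) :: 'b) $ n" by simp
qed

lemma rel_det_Un:
  fixes t :: "'b :: idom"
  assumes "finite V" "finite W" "V \<inter> W = {}" and R: "R \<subseteq> V \<times> V" and Q: "Q \<subseteq> W \<times> W"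
  shows "rel_det (V \<union> W) (R \<union> Q) t = rel_det V R t * rel_det W Q t"
proof -
  have "rel_det (V \<union> W) (R \<union> Q) t = rel_det V (R \<union> Q) t * rel_det W (R \<union> Q) t"
    unfolding rel_det_def using assms by (intro sdet_union) auto
  also have "rel_det V (R \<union> Q) t = rel_det V R t"
    unfolding rel_det_def using assms by (intro sdet_cong) auto
  also have "rel_det W (R \<union> Q) t = rel_det W Q t"
    unfolding rel_det_def using assms by (intro sdet_cong) auto
  finally show ?thesis .
qed

lemma rel_det_reindex:
  assumes "bij_betw f V W" "finite V"
    and "\<And>x y. x \<in> V \<Longrightarrow> y \<in> V \<Longrightarrow> (f x, f y) \<in> Q \<longleftrightarrow> (x, y) \<in> R"
  shows "rel_det W Q t = rel_det V R t"
  unfolding rel_det_def sdet_reindex[OF assms(1,2)] using assms(1,3)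
  by (intro sdet_cong) (auto simp: bij_betw_def inj_on_def)

section \<open>Bijection between covers and multicycles\<close>

definition arcs :: "('a \<Rightarrow> 'a) \<Rightarrow> 'a set \<Rightarrow> ('a \<times> 'a) set" where
  "arcs \<sigma> X = (\<lambda>x. (x, \<sigma> x)) ` X"

lemma fst_arcs [simp]: "fst ` arcs \<sigma> X = X"
  by (auto simp: arcs_def image_image)

lemma card_arcs [simp]: "card (arcs \<sigma> X) = card X"
  unfolding arcs_def by (intro card_image) (auto simp: inj_on_def)

lemma cycle_of_list_nth:
  assumes "distinct vs" "k < length vs"
  shows "cycle_of_list vs (vs ! k) = vs ! ((k + 1) mod length vs)"
proof -
  have "map (cycle_of_list vs) vs = rotate 1 vs"
    using cyclic_rotation[OF assms(1), of 1] by simp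
  then have "cycle_of_list vs (vs ! k) = rotate 1 vs ! k"
    using assms(2) by (metis nth_map)
  then show ?thesis using assms(2) by (simp add: nth_rotate del: rotate_Suc)
qed

lemma simple_cycle_iff:
  "simple_cycle Ed C \<longleftrightarrow>
     (\<exists>vs. vs \<noteq> [] \<and> distinct vs \<and> C = arcs (cycle_of_list vs) (set vs)) \<and> C \<subseteq> Ed"
proof -
  have eq: "{(vs ! k, vs ! ((k + 1) mod length vs)) | k. k < length vs} =
        arcs (cycle_of_list vs) (set vs)" if "distinct vs" for vs :: "'a list"
  proof -
    have "set vs = (!) vs ` {k. k < length vs}" by (auto simp: in_set_conv_nth)
    then have "arcs (cycle_of_list vs) (set vs) =
        (\<lambda>k. (vs ! k, cycle_of_list vs (vs ! k))) ` {k. k < length vs}"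
      by (simp add: arcs_def image_image)
    also have "\<dots> = (\<lambda>k. (vs ! k, vs ! ((k + 1) mod length vs))) ` {k. k < length vs}"
      using cycle_of_list_nth[OF that] by (intro image_cong) simp_all
    finally show ?thesis by auto
  qed
  show ?thesis
    unfolding simple_cycle_def by (intro conj_cong ex_cong1 refl) (simp only: eq)
qed

text \<open>A cycle of length l is a product of l - 1 transpositions. The separate factor -1 is what
  one cycle contributes to the weight of a multicycle.\<close>

lemma sign_cycle_of_list:
  assumes "distinct vs" "vs \<noteq> []"
  shows "sign (cycle_of_list vs) = - ((-1) ^ length vs)"
  using assms
proof (induction vs rule: cycle_of_list.induct)
  case (1 i j cs)
  then have "i \<noteq> j" "sign (cycle_of_list (j # cs)) = - ((-1) ^ length (j # cs))" by auto
  then show ?case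
    unfolding cycle_of_list.simps
    by (subst sign_compose[OF permutation_swap_id permutation_of_cycle]) (simp add: sign_swap_id)
qed auto

text \<open>The cyclic permutations of the members of \<open>M\<close> have disjoint supports, and
  \<sigma> is their composition. As a cycle of length l has sign -(-1)^l, the number of cycles is
  visible in sign \<sigma> once the total length is known.\<close>

lemma multicycle_imp_perm:
  assumes "multicycle Ed M"
  shows "\<exists>\<sigma>. finite (fst ` \<Union>M) \<and> \<sigma> permutes (fst ` \<Union>M) \<and> \<Union>M = arcs \<sigma> (fst ` \<Union>M) \<and>
           card (fst ` \<Union>M) = mc_length M \<and> (-1) ^ card M = (-1) ^ mc_length M * sign \<sigma>"
proof -
  have "finite M" using assms by (simp add: multicycle_def)
  then show ?thesis using assms
  proof (induction M)
    case empty
    show ?case by (intro exI[of _ id]) (auto simp: arcs_def mc_length_def permutes_id)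
  next
    case (insert C M)
    let ?X = "fst ` \<Union>M"
    have "multicycle Ed M" using insert.prems insert.hyps by (auto simp: multicycle_def)
    from insert.IH[OF this] obtain \<sigma> where \<sigma>: "finite ?X" "\<sigma> permutes ?X"
      "\<Union>M = arcs \<sigma> ?X" "card ?X = mc_length M" "(-1) ^ card M = (-1) ^ mc_length M * sign \<sigma>" by blast
    have "simple_cycle Ed C" using insert.prems by (auto simp: multicycle_def)
    then obtain vs where vs: "vs \<noteq> []" "distinct vs" "C = arcs (cycle_of_list vs) (set vs)"
      by (auto simp: simple_cycle_iff)
    have fC: "fst ` C = set vs" using vs by simp
    have disj: "set vs \<inter> ?X = {}"
    proof -
      have "C \<noteq> D" if "D \<in> M" for D using that insert.hyps by blast
      moreover have "\<forall>D\<in>insert C M. C \<noteq> D \<longrightarrow> fst ` C \<inter> fst ` D = {}"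
        using insert.prems unfolding multicycle_def by simp
      ultimately have "set vs \<inter> fst ` D = {}" if "D \<in> M" for D
        using that unfolding fC by simp
      then show ?thesis unfolding image_Union by auto
    qed
    have un: "fst ` \<Union>(insert C M) = set vs \<union> ?X" using fC by auto
    have cp: "cycle_of_list vs permutes set vs" by (rule cycle_permutes)
    have len: "mc_length (insert C M) = length vs + mc_length M"
      using insert.hyps vs by (simp add: mc_length_def distinct_card)
    show ?case unfolding un
    proof (intro exI[of _ "cycle_of_list vs \<circ> \<sigma>"] conjI)
      show "finite (set vs \<union> ?X)" using \<sigma>(1) by simp
      show "cycle_of_list vs \<circ> \<sigma> permutes (set vs \<union> ?X)"
        by (intro permutes_compose permutes_subset[OF cp] permutes_subset[OF \<sigma>(2)]) auto
      have "(cycle_of_list vs \<circ> \<sigma>) x = cycle_of_list vs x" if "x \<in> set vs" for x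
      proof -
        have "x \<notin> ?X" using that disj by blast
        then show ?thesis using permutes_not_in[OF \<sigma>(2), of x] by simp
      qed
      moreover have "(cycle_of_list vs \<circ> \<sigma>) x = \<sigma> x" if "x \<in> ?X" for x
        using that disj permutes_in_image[OF \<sigma>(2), of x] id_outside_supp[of "\<sigma> x" vs] by auto
      ultimately have "arcs (cycle_of_list vs \<circ> \<sigma>) (set vs \<union> ?X) = C \<union> arcs \<sigma> ?X"
        unfolding vs(3) arcs_def image_Un by (intro arg_cong2[of _ _ _ _ "(\<union>)"] image_cong) auto
      then show "\<Union>(insert C M) = arcs (cycle_of_list vs \<circ> \<sigma>) (set vs \<union> ?X)"
        using \<sigma>(3) by auto
      show "card (set vs \<union> ?X) = mc_length (insert C M)"
        using disj \<sigma>(1,4) len vs(2) by (simp add: card_Un_disjoint distinct_card)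
      have "sign (cycle_of_list vs \<circ> \<sigma>) = - ((-1) ^ length vs) * sign \<sigma>"
        using sign_compose[OF permutation_of_cycle permutes_imp_permutation[OF \<sigma>(1,2)]]
          sign_cycle_of_list[OF vs(2,1)] by simp
      then show "(-1) ^ card (insert C M) = (-1) ^ mc_length (insert C M) * sign (cycle_of_list vs \<circ> \<sigma>)"
        using insert.hyps \<sigma>(5) by (simp add: len power_add)
    qed
  qed
qed

lemma cycle_decomp_permutes:
  assumes "cycle_decomp I \<tau>"
  shows "\<tau> permutes I"
  using assms
proof (induction rule: cycle_decomp.induct)
  case (comp I \<tau> cs)
  then show ?case
    by (intro permutes_compose permutes_subset[OF cycle_permutes] permutes_subset[OF comp.IH]) auto
qed (simp add: permutes_def)

text \<open>The cycle decomposition of \<sigma> supplies the cycles; the induction turns each of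
  them into its set of arcs.\<close>

lemma perm_imp_multicycle:
  assumes "finite X" "\<sigma> permutes X" "arcs \<sigma> X \<subseteq> Ed"
  shows "\<exists>M. multicycle Ed M \<and> \<Union>M = arcs \<sigma> X"
proof -
  have "cycle_decomp X \<sigma>" using assms cycle_decomposition by blast
  then show ?thesis using assms
  proof (induction rule: cycle_decomp.induct)
    case empty
    show ?case by (intro exI[of _ "{}"]) (auto simp: multicycle_def arcs_def)
  next
    case (comp I \<tau> cs)
    have \<tau>: "finite I" "\<tau> permutes I"
      using comp.prems(1) cycle_decomp_permutes[OF comp.hyps(1)] by auto
    let ?C = "arcs (cycle_of_list cs) (set cs)"
    have "(cycle_of_list cs \<circ> \<tau>) x = cycle_of_list cs x" if "x \<in> set cs" for x
    proof -
      have "x \<notin> I" using that comp.hyps(3) by blast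
      then show ?thesis using permutes_not_in[OF \<tau>(2), of x] by simp
    qed
    moreover have "(cycle_of_list cs \<circ> \<tau>) x = \<tau> x" if "x \<in> I" for x
      using that comp.hyps(3) permutes_in_image[OF \<tau>(2), of x] id_outside_supp[of "\<tau> x" cs] by auto
    ultimately have arcs: "arcs (cycle_of_list cs \<circ> \<tau>) (set cs \<union> I) = ?C \<union> arcs \<tau> I"
      unfolding arcs_def image_Un by (intro arg_cong2[of _ _ _ _ "(\<union>)"] image_cong) auto
    have "arcs \<tau> I \<subseteq> Ed" using comp.prems(3) unfolding arcs by blast
    then obtain M where M: "multicycle Ed M" "\<Union>M = arcs \<tau> I"
      using comp.IH[OF \<tau>] by auto
    show ?case
    proof (cases "cs = []")
      \<comment> \<open>\<open>cycle_decomp\<close> allows empty cycles while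
        \<open>simple_cycle\<close> does not; they add no arcs and are left out.\<close>
      case True
      then show ?thesis using M arcs by (auto simp: arcs_def)
    next
      case False
      have C: "simple_cycle Ed ?C"
        unfolding simple_cycle_iff using False comp.hyps(2) comp.prems(3) unfolding arcs by blast
      have disj: "fst ` ?C \<inter> fst ` D = {}" if "D \<in> M" for D
      proof -
        have "fst ` D \<subseteq> fst ` \<Union>M" using that by blast
        then show ?thesis using M(2) comp.hyps(3) by auto
      qed
      have "multicycle Ed (insert ?C M)"
        using M(1) C disj unfolding multicycle_def by (simp add: Int_commute)
      moreover have "\<Union>(insert ?C M) = arcs (cycle_of_list cs \<circ> \<tau>) (set cs \<union> I)"
        unfolding arcs using M(2) by simp
      ultimately show ?thesis by blast
    qed
  qed
qed

text \<open>From the common arc \<open>e\<close> on, both cycles must continue along the same arcs,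
  because \<open>U\<close> offers at most one arc out of each vertex; going round once exhausts
  \<open>C\<close>.\<close>

lemma simple_cycle_subset:
  assumes C: "simple_cycle Ed C" and D: "simple_cycle Ed D"
    and U: "single_valued U" "C \<subseteq> U" "D \<subseteq> U" and e: "e \<in> C" "e \<in> D"
  shows "C \<subseteq> D"
proof -
  obtain vs where vs: "vs \<noteq> []" "distinct vs" "C = arcs (cycle_of_list vs) (set vs)"
    using C by (auto simp: simple_cycle_iff)
  obtain ws where ws: "D = arcs (cycle_of_list ws) (set ws)"
    using D by (auto simp: simple_cycle_iff)
  obtain v where v: "v \<in> set vs" "e = (v, cycle_of_list vs v)" using e vs by (auto simp: arcs_def)
  let ?c = "cycle_of_list vs" and ?d = "cycle_of_list ws"
  have mem: "(?c ^^ n) v \<in> set vs" for n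
    using v(1) permutes_in_image[OF cycle_permutes, of vs] by (induction n) auto
  have v': "((?c ^^ n) v, (?c ^^ Suc n) v) \<in> D" for n
  proof (induction n)
    case 0
    show ?case using e(2) v(2) by simp
  next
    case (Suc n)
    define w where "w = (?c ^^ Suc n) v"
    have "?d ((?c ^^ n) v) = w" "(?c ^^ n) v \<in> set ws"
      using Suc unfolding w_def ws arcs_def by auto
    then have "w \<in> set ws" using permutes_in_image[OF cycle_permutes, of ws] by metis
    then have D: "(w, ?d w) \<in> D" unfolding arcs_def ws by blast
    moreover have "(w, ?c w) \<in> C" using mem[of "Suc n"] unfolding w_def arcs_def vs(3) by blast
    ultimately have "?c w = ?d w" using U by (meson single_valuedD subsetD)
    then show ?case using D by (simp add: w_def)
  qed
  show ?thesis
  proof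
    fix d assume "d \<in> C"
    then obtain x where x: "x \<in> set vs" "d = (x, cycle_of_list vs x)" by (auto simp: vs arcs_def)
    obtain i j where ij: "i < length vs" "j < length vs" "v = vs ! i" "x = vs ! j"
      using x(1) v(1) by (metis in_set_conv_nth)
    have "(?c ^^ n) v = rotate n vs ! i" for n
      using cyclic_rotation[OF vs(2), of n] ij by (metis nth_map)
    \<comment> \<open>From index \<open>i\<close>, \<open>length vs - i\<close> steps lead round to
      index 0, and \<open>j\<close> more to index \<open>j\<close>; this also covers j < i.\<close>
    then have "(?c ^^ (length vs - i + j)) v = vs ! j"
      using ij by (simp add: nth_rotate)
    then show "d \<in> D" using v'[of "length vs - i + j"] x ij by simp
  qed
qed

text \<open>The union of a multicycle is the graph of a function by
  \<open>multicycle_imp_perm\<close>, so two cycles inside it that share an arc coincide.\<close>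

lemma multicycle_eqI:
  assumes "multicycle Ed M" "multicycle Ed M'" "\<Union>M = \<Union>M'"
  shows "M = M'"
proof -
  have sv: "single_valued (\<Union>M)" if M: "multicycle Ed M" for M
  proof -
    obtain \<sigma> where "\<Union>M = arcs \<sigma> (fst ` \<Union>M)" using multicycle_imp_perm[OF M] by blast
    moreover have "single_valued (arcs \<sigma> (fst ` \<Union>M))" by (auto simp: single_valued_def arcs_def)
    ultimately show ?thesis by metis
  qed
  have "M \<subseteq> M'" if M: "multicycle Ed M" "multicycle Ed M'" "\<Union>M = \<Union>M'" for M M'
  proof
    fix C assume "C \<in> M"
    then have C: "simple_cycle Ed C" using M by (auto simp: multicycle_def)
    then have "C \<noteq> {}" by (auto simp: simple_cycle_iff arcs_def)
    then obtain e where e: "e \<in> C" by blast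
    then obtain D where D: "D \<in> M'" "e \<in> D" using \<open>C \<in> M\<close> M(3) by blast
    have "simple_cycle Ed D" using D M(2) by (auto simp: multicycle_def)
    have CU: "C \<subseteq> \<Union>M" and DU: "D \<subseteq> \<Union>M" using \<open>C \<in> M\<close> D M(3) by auto
    have "C = D"
      using simple_cycle_subset[OF C \<open>simple_cycle Ed D\<close> sv[OF M(1)] CU DU e D(2)]
        simple_cycle_subset[OF \<open>simple_cycle Ed D\<close> C sv[OF M(1)] DU CU D(2) e] by blast
    then show "C \<in> M'" using D by simp
  qed
  then show ?thesis using assms by (metis subset_antisym)
qed

text \<open>The arcs recover the set as their first components, and off that set a permutation is
  the identity.\<close>

lemma arcs_inj:
  assumes "\<sigma> permutes X" "\<tau> permutes Y" "arcs \<sigma> X = arcs \<tau> Y"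
  shows "X = Y \<and> \<sigma> = \<tau>"
proof -
  have XY: "X = Y" using assms(3) by (metis fst_arcs)
  have "\<sigma> x = \<tau> x" for x
  proof (cases "x \<in> X")
    case True
    then have "(x, \<sigma> x) \<in> arcs \<tau> Y" using assms(3) by (auto simp: arcs_def)
    then show ?thesis by (auto simp: arcs_def)
  next
    case False
    then show ?thesis using assms XY permutes_not_in by metis
  qed
  then show ?thesis using XY by blast
qed

text \<open>Decomposing the permutation of a cover into cycles is a bijection onto the multicycles
  of length \<open>k\<close> that respects the weights. \<open>Ed\<close> may be infinite, as needed
  for \<Gamma>.\<close>

lemma spectral_coeff_eq_cover_coeff: "spectral_coeff Ed k = cover_coeff Ed k"
proof -
  define mc where "mc = (\<lambda>(X, \<sigma>). THE M. multicycle Ed M \<and> \<Union>M = arcs \<sigma> X)"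
  have mc: "multicycle Ed (mc (X, \<sigma>)) \<and> \<Union>(mc (X, \<sigma>)) = arcs \<sigma> X" if c: "(X, \<sigma>) \<in> covers Ed k" for X \<sigma>
  proof -
    have "arcs \<sigma> X \<subseteq> Ed" using c by (auto simp: covers_def arcs_def)
    then obtain M where M: "multicycle Ed M" "\<Union>M = arcs \<sigma> X"
      using perm_imp_multicycle[of X \<sigma> Ed] c by (auto simp: covers_def)
    have "\<exists>!M. multicycle Ed M \<and> \<Union>M = arcs \<sigma> X"
    proof (rule ex1I[of _ M])
      fix N assume "multicycle Ed N \<and> \<Union>N = arcs \<sigma> X"
      then show "N = M" using multicycle_eqI[of Ed N M] M by simp
    qed (simp add: M)
    then show ?thesis unfolding mc_def split by (rule theI')
  qed
  have mc_prop: "mc_length (mc (X, \<sigma>)) = k" "(-1) ^ card (mc (X, \<sigma>)) = (-1) ^ k * sign \<sigma>"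
    if c: "(X, \<sigma>) \<in> covers Ed k" for X \<sigma>
  proof -
    let ?M = "mc (X, \<sigma>)"
    obtain \<tau> where \<tau>: "\<tau> permutes (fst ` \<Union>?M)" "\<Union>?M = arcs \<tau> (fst ` \<Union>?M)"
       "card (fst ` \<Union>?M) = mc_length ?M" "(-1) ^ card ?M = (-1) ^ mc_length ?M * sign \<tau>"
      using multicycle_imp_perm[OF mc[OF c, THEN conjunct1]] by blast
    have "X = fst ` \<Union>?M \<and> \<sigma> = \<tau>"
      using arcs_inj[of \<sigma> X \<tau>] \<tau>(1,2) mc[OF c] c by (auto simp: covers_def)
    then show "mc_length ?M = k" "(-1) ^ card ?M = (-1) ^ k * sign \<sigma>"
      using \<tau>(3,4) c by (auto simp: covers_def)
  qed
  have "bij_betw mc (covers Ed k) {M. multicycle Ed M \<and> mc_length M = k}"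
  proof (rule bij_betw_imageI)
    show "inj_on mc (covers Ed k)"
    proof (rule inj_onI)
      fix c d assume cd: "c \<in> covers Ed k" "d \<in> covers Ed k" "mc c = mc d"
      obtain X \<sigma> Y \<tau> where [simp]: "c = (X, \<sigma>)" "d = (Y, \<tau>)" by (cases c, cases d)
      have "arcs \<sigma> X = arcs \<tau> Y" using mc[of X \<sigma>] mc[of Y \<tau>] cd by simp
      then show "c = d" using arcs_inj[of \<sigma> X \<tau> Y] cd by (auto simp: covers_def)
    qed
    show "mc ` covers Ed k = {M. multicycle Ed M \<and> mc_length M = k}"
    proof (intro equalityI subsetI)
      fix M assume "M \<in> mc ` covers Ed k"
      then show "M \<in> {M. multicycle Ed M \<and> mc_length M = k}" using mc mc_prop by auto
    next
      fix M assume "M \<in> {M. multicycle Ed M \<and> mc_length M = k}"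
      then have M: "multicycle Ed M" "mc_length M = k" by auto
      let ?X = "fst ` \<Union>M"
      obtain \<sigma> where \<sigma>: "finite ?X" "\<sigma> permutes ?X" "\<Union>M = arcs \<sigma> ?X" "card ?X = mc_length M"
        using multicycle_imp_perm[OF M(1)] by (elim exE conjE)
      have "C \<subseteq> Ed" if "C \<in> M" for C
        using M(1) that by (simp add: multicycle_def simple_cycle_def)
      then have "\<Union>M \<subseteq> Ed" by blast
      moreover have "(x, \<sigma> x) \<in> \<Union>M" if "x \<in> ?X" for x
      proof -
        have "(x, \<sigma> x) \<in> arcs \<sigma> ?X" unfolding arcs_def using that by (rule imageI)
        then show ?thesis by (subst \<sigma>(3))
      qed
      ultimately have c: "(?X, \<sigma>) \<in> covers Ed k"
        unfolding covers_def using \<sigma>(1,2,4) M(2) by blast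
      have "\<Union>(mc (?X, \<sigma>)) = \<Union>M"
        using mc[OF c, THEN conjunct2] by (rule trans[OF _ \<sigma>(3)[symmetric]])
      then have "mc (?X, \<sigma>) = M"
        using multicycle_eqI[of Ed "mc (?X, \<sigma>)" M] mc[OF c] M(1) by simp
      then show "M \<in> mc ` covers Ed k" using c by (metis imageI)
    qed
  qed
  from sum.reindex_bij_betw[OF this, of "\<lambda>M. (-1) ^ card M :: int", symmetric]
  show ?thesis unfolding spectral_coeff_def cover_coeff_def
    using mc_prop(2) by (auto intro!: sum.cong)
qed

section \<open>Finite models of the wedge\<close>

text \<open>Once coordinates can wrap around, a step may reverse their order, so vertices are built
  from unordered pairs.\<close>

definition sorted_pair :: "nat \<Rightarrow> nat \<Rightarrow> nat \<times> nat" where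
  "sorted_pair i j = (min i j, max i j)"

lemma sorted_pair_commute: "sorted_pair i j = sorted_pair j i"
  by (simp add: sorted_pair_def min.commute max.commute)

lemma sorted_pair_eq_iff: "sorted_pair i j = sorted_pair k l \<longleftrightarrow> i = k \<and> j = l \<or> i = l \<and> j = k"
  by (auto simp: sorted_pair_def min_def max_def)

lemma sorted_pair_eq_Pair: "i \<le> j \<Longrightarrow> sorted_pair i j = (i, j)"
  by (simp add: sorted_pair_def)

lemma sorted_pair_cases: obtains "sorted_pair i j = (i, j)" "i \<le> j" | "sorted_pair i j = (j, i)" "j \<le> i"
  by (cases "i \<le> j") (auto simp: sorted_pair_def min_def max_def)

text \<open>Stepping past \<open>n\<close> goes back by one period only, to the number congruent to \<open>n + 1\<close>.\<close>
definition wsucc :: "nat \<Rightarrow> nat \<Rightarrow> nat \<Rightarrow> nat" where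
  "wsucc p n i = (if i < n then i + 1 else i + 1 - p)"

text \<open>This is the least element of the class of \<open>i\<close>; the representatives above
  \<open>q\<close> are q + 1, ..., q + p.\<close>

definition class_rep :: "nat \<Rightarrow> nat \<Rightarrow> nat \<Rightarrow> nat" where
  "class_rep p q i = (if i \<le> q then i else q + 1 + (i - q - 1) mod p)"

lemma eqv_pq_iff_class_rep:
  assumes "p \<ge> 1"
  shows "eqv_pq p q i j \<longleftrightarrow> class_rep p q i = class_rep p q j"
proof (cases "q + 1 \<le> min i j")
  case True
  define a b where "a = i - q - 1" and "b = j - q - 1"
  have ij: "i = (q + 1) + a" "j = (q + 1) + b" using True by (auto simp: a_def b_def)
  have "i mod p = j mod p \<longleftrightarrow> a mod p = b mod p"
    unfolding ij using cong_add_lcancel_nat[of "q + 1" a b p] by (simp add: cong_def)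
  then show ?thesis using True by (auto simp: eqv_pq_def class_rep_def a_def b_def)
next
  case False
  have "i \<le> q \<Longrightarrow> \<not> j \<le> q \<Longrightarrow> i \<noteq> q + 1 + (j - q - 1) mod p"
    "j \<le> q \<Longrightarrow> \<not> i \<le> q \<Longrightarrow> q + 1 + (i - q - 1) mod p \<noteq> j" by linarith+
  then show ?thesis using False by (auto simp: eqv_pq_def class_rep_def)
qed

text \<open>On representatives the successor is that of the model with n = q + p, where q + p is
  followed by q + 1.\<close>

lemma class_rep_Suc:
  assumes "p \<ge> 1"
  shows "class_rep p q (i + 1) = wsucc p (q + p) (class_rep p q i)"
proof (cases "i \<le> q")
  case True
  then show ?thesis using assms by (auto simp: class_rep_def wsucc_def)
next
  case False
  define a where "a = i - q - 1"
  have i: "i = q + 1 + a" using False by (simp add: a_def)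
  have "a mod p < p" using assms by simp
  show ?thesis
    using assms \<open>a mod p < p\<close> unfolding i by (auto simp: class_rep_def wsucc_def mod_Suc)
qed

lemma class_rep_id: "i \<le> q + p \<Longrightarrow> class_rep p q i = i"
  by (auto simp: class_rep_def)

lemma class_rep_le:
  assumes "p \<ge> 1"
  shows "class_rep p q i \<le> q + p"
proof -
  have "(i - q - 1) mod p < p" using assms by simp
  then show ?thesis by (simp add: class_rep_def)
qed

lemma class_rep_ge_1: "1 \<le> i \<Longrightarrow> 1 \<le> class_rep p q i"
  by (auto simp: class_rep_def)

definition model_verts :: "nat \<Rightarrow> (nat \<times> nat) set" where
  "model_verts n = {(i, j). 1 \<le> i \<and> i \<le> j \<and> j \<le> n}"

lemma finite_model_verts: "finite (model_verts n)"
  by (rule finite_subset[of _ "{1..n} \<times> {1..n}"]) (auto simp: model_verts_def)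

lemma sorted_pair_in_model_verts: "sorted_pair i j \<in> model_verts n \<longleftrightarrow> 1 \<le> i \<and> 1 \<le> j \<and> i \<le> n \<and> j \<le> n"
  by (auto simp: sorted_pair_def model_verts_def)

lemma wedge_domE:
  assumes "v \<in> wedge_dom"
  obtains i j where "v = (i, j)" "v = sorted_pair i j" "1 \<le> i" "i \<le> j"
  using assms by (cases v) (auto simp: wedge_dom_def sorted_pair_def)

lemma model_vertsE:
  assumes "v \<in> model_verts n"
  obtains i j where "v = sorted_pair i j" "1 \<le> i" "1 \<le> j" "i \<le> n" "j \<le> n"
proof -
  obtain a b where "v = (a, b)" by (cases v)
  then show thesis using assms by (intro that[of a b]) (auto simp: model_verts_def sorted_pair_eq_Pair)
qed

locale labeled_wedge =
  fixes Phi :: "nat \<times> nat \<Rightarrow> wlabel" and p q :: nat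
  assumes p: "p \<ge> 1" and periodic: "periodic_wedge Phi p q"
begin

abbreviation same :: "nat \<Rightarrow> nat \<Rightarrow> bool" where "same \<equiv> eqv_pq p q"
abbreviation lab :: "nat \<Rightarrow> nat \<Rightarrow> wlabel" where "lab i j \<equiv> Phi (sorted_pair i j)"

lemma same_sym: "same i j \<longleftrightarrow> same j i"
  by (auto simp: eqv_pq_def)

lemma lab_cong:
  assumes "same i k" "same j l" "1 \<le> i" "1 \<le> j" "1 \<le> k" "1 \<le> l"
  shows "lab i j = lab k l"
proof -
  have "sorted_pair i j \<in> wedge_dom" "sorted_pair k l \<in> wedge_dom"
    using assms by (auto simp: sorted_pair_def wedge_dom_def)
  moreover have "eqv_pair p q (sorted_pair i j) (sorted_pair k l)"
    using assms(1,2) by (cases i j rule: sorted_pair_cases; cases k l rule: sorted_pair_cases) (auto simp: eqv_pair_def)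
  ultimately show ?thesis using periodic by (auto simp: periodic_wedge_def)
qed

lemma lab_E_iff:
  assumes "1 \<le> i" "1 \<le> j"
  shows "lab i j = E \<longleftrightarrow> same i j"
proof -
  have *: "Phi (i, j) = E \<longleftrightarrow> same i j" if "1 \<le> i" "i \<le> j" for i j
    using periodic that by (auto simp: periodic_wedge_def wedge_dom_def)
  show ?thesis
    by (cases i j rule: sorted_pair_cases) (use * assms same_sym in auto)
qed

definition out_nbrs :: "nat \<Rightarrow> nat \<Rightarrow> nat \<Rightarrow> (nat \<times> nat) set" where
  "out_nbrs n i j = (case lab i j of
      N \<Rightarrow> {sorted_pair (wsucc p n i) (wsucc p n j)}
    | S \<Rightarrow> {sorted_pair 1 (wsucc p n i), sorted_pair 1 (wsucc p n j)}
    | E \<Rightarrow> {})"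

lemma out_nbrs_commute: "out_nbrs n i j = out_nbrs n j i"
  unfolding out_nbrs_def sorted_pair_commute[of i j] sorted_pair_commute[of "wsucc p n i"] by (auto split: wlabel.splits)

text \<open>A relation would lose the double edge at an S-vertex whose two coordinates have the same
  successor. For n \<ge> q + p + 1 there is no such vertex, by
  \<open>wsucc_eq_imp_same\<close>.\<close>

definition model_edges :: "nat \<Rightarrow> ((nat \<times> nat) \<times> (nat \<times> nat)) set" where
  "model_edges n = {(v, w). v \<in> model_verts n \<and> w \<in> out_nbrs n (fst v) (snd v)}"

lemma model_edges_Image:
  assumes "1 \<le> i" "1 \<le> j" "i \<le> n" "j \<le> n"
  shows "model_edges n `` {sorted_pair i j} = out_nbrs n i j"
  using assms sorted_pair_in_model_verts[of i j n] out_nbrs_commute[of n i j]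
  by (cases i j rule: sorted_pair_cases) (auto simp: model_edges_def)

lemma wsucc_range:
  assumes "n \<ge> q + p" "1 \<le> i" "i \<le> n"
  shows "1 \<le> wsucc p n i" "wsucc p n i \<le> n"
  using assms p by (auto simp: wsucc_def)

lemma out_nbrs_subset:
  assumes "n \<ge> q + p" "1 \<le> i" "i \<le> n" "1 \<le> j" "j \<le> n"
  shows "out_nbrs n i j \<subseteq> model_verts n"
  using wsucc_range[OF assms(1)] assms p
  by (auto simp: out_nbrs_def sorted_pair_in_model_verts split: wlabel.splits)

lemma model_edges_subset:
  assumes "n \<ge> q + p"
  shows "model_edges n \<subseteq> model_verts n \<times> model_verts n"
proof (rule subrelI)
  fix v w assume "(v, w) \<in> model_edges n"
  then have v: "v \<in> model_verts n" and w: "w \<in> out_nbrs n (fst v) (snd v)"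
    by (simp_all add: model_edges_def)
  have "1 \<le> fst v" "fst v \<le> n" "1 \<le> snd v" "snd v \<le> n"
    using v by (auto simp: model_verts_def)
  then have "w \<in> model_verts n" using out_nbrs_subset[OF assms] w by blast
  then show "(v, w) \<in> model_verts n \<times> model_verts n" using v by simp
qed

section \<open>Merging the top coordinate\<close>

definition fold_top :: "nat \<Rightarrow> nat \<Rightarrow> nat" where
  "fold_top n i = (if i = n + 1 then n + 1 - p else i)"

definition fold_pair :: "nat \<Rightarrow> nat \<times> nat \<Rightarrow> nat \<times> nat" where
  "fold_pair n v = sorted_pair (fold_top n (fst v)) (fold_top n (snd v))"

lemma fold_pair_sorted_pair: "fold_pair n (sorted_pair i j) = sorted_pair (fold_top n i) (fold_top n j)"
  by (cases i j rule: sorted_pair_cases) (auto simp: fold_pair_def sorted_pair_commute)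

lemma fold_top_range:
  assumes "n \<ge> q + p" "1 \<le> i" "i \<le> n + 1"
  shows "1 \<le> fold_top n i" "fold_top n i \<le> n" "same i (fold_top n i)"
proof -
  show "1 \<le> fold_top n i" "fold_top n i \<le> n" using assms p by (auto simp: fold_top_def)
  have "(n + 1) mod p = (n + 1 - p) mod p" using assms by (simp add: le_mod_geq)
  then show "same i (fold_top n i)" using assms by (auto simp: fold_top_def eqv_pq_def)
qed

lemma wsucc_fold_top:
  assumes "n \<ge> q + p" "1 \<le> i" "i \<le> n + 1"
  shows "wsucc p (n + 1) (fold_top n i) = wsucc p (n + 1) i"
  using assms p by (auto simp: fold_top_def wsucc_def)

lemma fold_top_wsucc:
  assumes "n \<ge> q + p" "i \<le> n"
  shows "fold_top n (wsucc p (n + 1) i) = wsucc p n i"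
  using assms p by (auto simp: fold_top_def wsucc_def)

lemma fold_top_1: "n \<ge> q + p \<Longrightarrow> fold_top n 1 = 1"
  using p by (auto simp: fold_top_def)

text \<open>In the model with top coordinate n + 1, the coordinates n + 1 and n + 1 - p have the
  same successor n + 2 - p; being equivalent, they also give the same labels.\<close>

lemma model_edges_fold_pair:
  assumes n: "n \<ge> q + p" and v: "v \<in> model_verts (n + 1)"
  shows "model_edges (n + 1) `` {v} = model_edges (n + 1) `` {fold_pair n v}"
proof -
  obtain i j where ij: "v = sorted_pair i j" "1 \<le> i" "1 \<le> j" "i \<le> n + 1" "j \<le> n + 1"
    using v by (rule model_vertsE)
  note fi = fold_top_range[OF n ij(2,4)] and fj = fold_top_range[OF n ij(3,5)]
  have "lab i j = lab (fold_top n i) (fold_top n j)"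
    using lab_cong fi fj ij by blast
  then have "out_nbrs (n + 1) i j = out_nbrs (n + 1) (fold_top n i) (fold_top n j)"
    unfolding out_nbrs_def wsucc_fold_top[OF n ij(2,4)] wsucc_fold_top[OF n ij(3,5)] by simp
  then show ?thesis
    using ij fi fj by (simp add: fold_pair_sorted_pair model_edges_Image)
qed

lemma fold_pair_range:
  assumes "n \<ge> q + p" "v \<in> model_verts (n + 1)"
  shows "fold_pair n v \<in> model_verts n"
  using fold_top_range[OF assms(1)] assms(2)
  by (auto elim!: model_vertsE simp: fold_pair_sorted_pair sorted_pair_in_model_verts)

text \<open>The only collision of \<open>wsucc\<close> is between n and n - p, both followed by n +
  1 - p. These are equivalent because n - p \<ge> q + 1, which is why the simple models start at q +
  p + 1 rather than q + p.\<close>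

lemma wsucc_eq_imp_same:
  assumes "n \<ge> q + p + 1" "i \<le> n" "j \<le> n" "wsucc p n i = wsucc p n j"
  shows "same i j"
proof (cases "i = j")
  case False
  then have "i = n \<and> j = n - p \<or> j = n \<and> i = n - p"
    using assms p by (auto simp: wsucc_def split: if_splits)
  moreover have "n mod p = (n - p) mod p" using assms by (simp add: le_mod_geq)
  ultimately show ?thesis using assms by (auto simp: eqv_pq_def)
qed (simp add: eqv_pq_def)

lemma rel_det_model_step:
  fixes t :: "'b :: idom"
  assumes n: "n \<ge> q + p + 1"
  shows "rel_det (model_verts (n + 1)) (model_edges (n + 1)) t = rel_det (model_verts n) (model_edges n) t"
proof (rule rel_det_merge[where \<pi> = "fold_pair n"])
  have n': "n \<ge> q + p" "n + 1 \<ge> q + p" using n by auto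
  show "finite (model_verts (n + 1))" by (rule finite_model_verts)
  show "model_verts n \<subseteq> model_verts (n + 1)" by (auto simp: model_verts_def)
  show "model_edges (n + 1) \<subseteq> model_verts (n + 1) \<times> model_verts (n + 1)"
    by (rule model_edges_subset) (use n in simp)
  show "fold_pair n x \<in> model_verts n" if "x \<in> model_verts (n + 1)" for x
    using fold_pair_range[OF n'(1) that] .
  show "model_edges (n + 1) `` {x} = model_edges (n + 1) `` {fold_pair n x}"
    if "x \<in> model_verts (n + 1)" for x
    using model_edges_fold_pair[OF n'(1) that] .
  fix x assume "x \<in> model_verts n"
  then obtain i j where ij: "x = sorted_pair i j" "1 \<le> i" "1 \<le> j" "i \<le> n" "j \<le> n"
    by (rule model_vertsE)
  then have im: "model_edges (n + 1) `` {x} = out_nbrs (n + 1) i j" "model_edges n `` {x} = out_nbrs n i j"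
    by (auto simp: model_edges_Image)
  have fw: "fold_top n (wsucc p (n + 1) i) = wsucc p n i" "fold_top n (wsucc p (n + 1) j) = wsucc p n j"
    using fold_top_wsucc[OF n'(1)] ij by auto
  have f1: "fold_top n 1 = 1" using fold_top_1[OF n'(1)] .
  show "model_edges n `` {x} = fold_pair n ` (model_edges (n + 1) `` {x})"
    unfolding im out_nbrs_def
    by (cases "lab i j") (simp_all add: fold_pair_sorted_pair fw[simplified] f1[simplified])
  show "inj_on (fold_pair n) (model_edges (n + 1) `` {x})"
  proof (cases "lab i j = S")
    case True
    \<comment> \<open>Equivalent coordinates are labelled E, so the two targets of an S-vertex
      remain distinct after folding.\<close>
    then have "\<not> same i j" using lab_E_iff ij by (metis wlabel.distinct(5))
    then have "wsucc p n i \<noteq> wsucc p n j" using wsucc_eq_imp_same[OF n] ij by blast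
    then show ?thesis
      unfolding im by (auto simp: out_nbrs_def True fold_pair_sorted_pair fw[simplified] f1[simplified] sorted_pair_eq_iff)
  next
    case False
    then show ?thesis unfolding im by (auto simp: out_nbrs_def split: wlabel.splits)
  qed
qed

lemma rel_det_model:
  fixes t :: "'b :: idom"
  assumes "n \<ge> q + p + 1"
  shows "rel_det (model_verts n) (model_edges n) t =
    rel_det (model_verts (q + p + 1)) (model_edges (q + p + 1)) t"
  using assms
proof (induction n rule: dec_induct)
  case (step n)
  then show ?case using rel_det_model_step[of n t] by simp
qed simp

text \<open>Both edges leaving an \<open>S\<close>-vertex may end in the same class, so this can be \<open>2\<close>.\<close>
definition edge_mult :: "nat \<Rightarrow> nat \<Rightarrow> nat \<times> nat \<Rightarrow> nat" where
  "edge_mult i j y = (case lab i j of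
      N \<Rightarrow> of_bool (sorted_pair (wsucc p (q + p) i) (wsucc p (q + p) j) = y)
    | S \<Rightarrow> of_bool (sorted_pair 1 (wsucc p (q + p) i) = y) + of_bool (sorted_pair 1 (wsucc p (q + p) j) = y)
    | E \<Rightarrow> 0)"

lemma edge_mult_commute: "edge_mult i j y = edge_mult j i y"
  unfolding edge_mult_def sorted_pair_commute[of i j] sorted_pair_commute[of "wsucc p (q + p) i" "wsucc p (q + p) j"]
  by (simp add: add.commute split: wlabel.splits)

lemma card_filter_single: "card {w \<in> {z}. P w} = of_bool (P z)"
  by (cases "P z") (auto simp: conj_disj_distribR Collect_disj_eq cong: conj_cong)

lemma card_filter_pair:
  assumes "z \<noteq> z'"
  shows "card {w \<in> {z, z'}. P w} = of_bool (P z) + of_bool (P z')"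
proof -
  have "{w \<in> {z, z'}. P w} = {w \<in> {z}. P w} \<union> {w \<in> {z'}. P w}" by auto
  also have "card \<dots> = card {w \<in> {z}. P w} + card {w \<in> {z'}. P w}"
    using assms by (intro card_Un_disjoint) auto
  finally show ?thesis by (simp only: card_filter_single)
qed

text \<open>At n = q + p folding may identify the two targets of an S-vertex, so edges are counted
  with multiplicity. Before folding the targets differ, since \<open>wsucc\<close> only adds 1 to
  coordinates up to q + p.\<close>

lemma card_model_nbrs:
  assumes ij: "1 \<le> i" "1 \<le> j" "i \<le> q + p" "j \<le> q + p"
  shows "card {v \<in> out_nbrs (q + p + 1) i j. fold_pair (q + p) v = y} = edge_mult i j y"
proof -
  have fw: "fold_top (q + p) (wsucc p (q + p + 1) i) = wsucc p (q + p) i"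
    "fold_top (q + p) (wsucc p (q + p + 1) j) = wsucc p (q + p) j"
    using fold_top_wsucc ij by auto
  have f1: "fold_top (q + p) 1 = 1" using fold_top_1 by simp
  show ?thesis
  proof (cases "lab i j")
    case N
    then show ?thesis by (simp only: out_nbrs_def edge_mult_def card_filter_single fold_pair_sorted_pair fw wlabel.case)
  next
    case S
    then have "\<not> same i j" using lab_E_iff ij by (metis wlabel.distinct(5))
    then have "i \<noteq> j" by (auto simp: eqv_pq_def)
    then have neq: "sorted_pair 1 (wsucc p (q + p + 1) i) \<noteq> sorted_pair 1 (wsucc p (q + p + 1) j)"
      using ij by (auto simp: sorted_pair_eq_iff wsucc_def)
    show ?thesis
      using S by (simp only: out_nbrs_def edge_mult_def card_filter_pair[OF neq] fold_pair_sorted_pair fw f1 wlabel.case)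
  qed (simp add: out_nbrs_def edge_mult_def)
qed

section \<open>Classes of the quotient and their representatives\<close>

definition rep_pair :: "nat \<times> nat \<Rightarrow> nat \<times> nat" where
  "rep_pair v = sorted_pair (class_rep p q (fst v)) (class_rep p q (snd v))"

lemma eqv_pair_iff: "eqv_pair p q v w \<longleftrightarrow> rep_pair v = rep_pair w"
  by (auto simp: eqv_pair_def rep_pair_def sorted_pair_eq_iff eqv_pq_iff_class_rep[OF p])

lemma rep_pair_sorted_pair: "rep_pair (sorted_pair i j) = sorted_pair (class_rep p q i) (class_rep p q j)"
  by (cases i j rule: sorted_pair_cases) (auto simp: rep_pair_def sorted_pair_commute)

lemma rep_pair_range:
  assumes "v \<in> wedge_dom"
  shows "rep_pair v \<in> model_verts (q + p)"
proof -
  obtain i j where "v = sorted_pair i j" "1 \<le> i" "i \<le> j" using assms by (rule wedge_domE)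
  then show ?thesis
    using class_rep_ge_1[of i p q] class_rep_ge_1[of j p q] class_rep_le[OF p]
    by (simp add: rep_pair_sorted_pair sorted_pair_in_model_verts)
qed

lemma rep_pair_id: "v \<in> model_verts (q + p) \<Longrightarrow> rep_pair v = v"
  by (auto elim!: model_vertsE simp: rep_pair_sorted_pair class_rep_id)

lemma model_verts_subset: "model_verts n \<subseteq> wedge_dom"
  by (auto simp: model_verts_def wedge_dom_def)

lemma wedge_edges_Image:
  assumes "1 \<le> i" "i \<le> j"
  shows "wedge_edges Phi `` {(i, j)} = (case lab i j of
      N \<Rightarrow> {sorted_pair (i + 1) (j + 1)} | S \<Rightarrow> {sorted_pair 1 (i + 1), sorted_pair 1 (j + 1)} | E \<Rightarrow> {})"
  using assms by (auto simp: wedge_edges_def wedge_dom_def sorted_pair_eq_Pair split: wlabel.splits)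

text \<open>\<open>class_rep\<close> preserves labels and commutes with the successor, so the edges
  from a vertex of \<Gamma> into a class can be counted at the representative of that
  vertex.\<close>

lemma card_wedge_nbrs:
  assumes ij: "1 \<le> i" "i \<le> j"
  shows "card {w. (sorted_pair i j, w) \<in> wedge_edges Phi \<and> rep_pair w = y} = edge_mult (class_rep p q i) (class_rep p q j) y"
proof -
  have lab: "lab (class_rep p q i) (class_rep p q j) = lab i j"
  proof (rule lab_cong)
    show "same (class_rep p q i) i" "same (class_rep p q j) j"
      unfolding eqv_pq_iff_class_rep[OF p] by (simp_all add: class_rep_id class_rep_le[OF p])
  qed (use ij class_rep_ge_1 in auto)
  have rs: "class_rep p q (i + 1) = wsucc p (q + p) (class_rep p q i)" "class_rep p q (j + 1) = wsucc p (q + p) (class_rep p q j)"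
    by (rule class_rep_Suc[OF p])+
  have r1: "class_rep p q 1 = 1" using p by (intro class_rep_id) simp
  have "{w. (sorted_pair i j, w) \<in> wedge_edges Phi \<and> rep_pair w = y} =
        {w \<in> wedge_edges Phi `` {(i, j)}. rep_pair w = y}"
    using ij by (auto simp: sorted_pair_eq_Pair)
  also have "card \<dots> = edge_mult (class_rep p q i) (class_rep p q j) y"
  proof (cases "lab i j")
    case N
    then show ?thesis
      by (simp only: wedge_edges_Image[OF ij] edge_mult_def lab card_filter_single rep_pair_sorted_pair rs wlabel.case)
  next
    case S
    then have "\<not> same i j" using lab_E_iff ij by (metis wlabel.distinct(5) le_trans)
    then have "i \<noteq> j" by (auto simp: eqv_pq_def)
    then have neq: "sorted_pair 1 (i + 1) \<noteq> sorted_pair 1 (j + 1)" by (auto simp: sorted_pair_eq_iff)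
    show ?thesis using S
      by (simp only: wedge_edges_Image[OF ij] edge_mult_def lab card_filter_pair[OF neq] rep_pair_sorted_pair rs r1 wlabel.case)
  qed (simp add: wedge_edges_Image[OF ij] edge_mult_def lab)
  finally show ?thesis .
qed

definition pair_class :: "nat \<times> nat \<Rightarrow> (nat \<times> nat) set" where
  "pair_class x = {v \<in> wedge_dom. rep_pair v = x}"

text \<open>\<open>rep_pair\<close> maps \<open>wedge_dom\<close> onto
  \<open>model_verts (q + p)\<close> and fixes every element there, so these vertices form a
  transversal of the classes.\<close>

lemma pair_class_bij: "bij_betw pair_class (model_verts (q + p)) (quot_verts p q)"
proof (rule bij_betw_imageI)
  show "inj_on pair_class (model_verts (q + p))"
  proof (rule inj_onI)
    fix x y assume xy: "x \<in> model_verts (q + p)" "y \<in> model_verts (q + p)" "pair_class x = pair_class y"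
    have "x \<in> pair_class x"
      unfolding pair_class_def using xy(1) model_verts_subset rep_pair_id[OF xy(1)] by blast
    then have "x \<in> pair_class y" unfolding xy(3) .
    then show "x = y" using rep_pair_id[OF xy(1)] unfolding pair_class_def by simp
  qed
  have "{(v, w). v \<in> wedge_dom \<and> w \<in> wedge_dom \<and> eqv_pair p q v w} `` {v} = pair_class (rep_pair v)"
    if "v \<in> wedge_dom" for v
    using that by (auto simp: pair_class_def eqv_pair_iff)
  then have "quot_verts p q = (\<lambda>v. pair_class (rep_pair v)) ` wedge_dom"
    unfolding quot_verts_def quotient_def by auto
  also have "\<dots> = pair_class ` model_verts (q + p)"
  proof -
    have "rep_pair ` wedge_dom = model_verts (q + p)"
      using rep_pair_range rep_pair_id model_verts_subset by (force simp: image_iff)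
    then show ?thesis by (metis image_image)
  qed
  finally show "pair_class ` model_verts (q + p) = quot_verts p q" by simp
qed

text \<open>The vertex chosen by \<open>SOME\<close> in \<open>quot_adj\<close> does not matter: its
  edge counts depend only on its \<open>rep_pair\<close>, and \<open>edge_mult\<close> is symmetric
  in the two coordinates.\<close>

lemma quot_adj_pair_class:
  assumes ij: "1 \<le> i" "1 \<le> j" "i \<le> q + p" "j \<le> q + p" and y: "y \<in> model_verts (q + p)"
  shows "quot_adj Phi (pair_class (sorted_pair i j)) (pair_class y) = edge_mult i j y"
proof -
  define u where "u = (SOME v. v \<in> pair_class (sorted_pair i j))"
  have "sorted_pair i j \<in> model_verts (q + p)" using ij by (simp add: sorted_pair_in_model_verts)
  then have "sorted_pair i j \<in> pair_class (sorted_pair i j)"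
    using rep_pair_id model_verts_subset by (auto simp: pair_class_def)
  then have "u \<in> pair_class (sorted_pair i j)" unfolding u_def by (rule someI)
  then have u: "u \<in> wedge_dom" "rep_pair u = sorted_pair i j" by (auto simp: pair_class_def)
  then obtain k l where kl: "u = sorted_pair k l" "1 \<le> k" "k \<le> l" by (metis wedge_domE)
  have dom: "w \<in> wedge_dom" if "(v, w) \<in> wedge_edges Phi" for v w
    using that by (auto simp: wedge_edges_def wedge_dom_def)
  have "quot_adj Phi (pair_class (sorted_pair i j)) (pair_class y) = card {w. (sorted_pair k l, w) \<in> wedge_edges Phi \<and> rep_pair w = y}"
    unfolding quot_adj_def u_def[symmetric] kl(1)
    by (rule arg_cong[of _ _ card]) (use dom[of "sorted_pair k l"] in \<open>auto simp: pair_class_def\<close>)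
  also have "\<dots> = edge_mult (class_rep p q k) (class_rep p q l) y" by (rule card_wedge_nbrs[OF kl(2,3)])
  also have "\<dots> = edge_mult i j y"
    using u(2) edge_mult_commute unfolding kl(1) rep_pair_sorted_pair sorted_pair_eq_iff by metis
  finally show ?thesis .
qed

text \<open>One last merge, from q + p + 1 down to q + p, reaches the adjacency matrix of
  \<open>\<Gamma>\<^sub>1\<close>. Double edges can arise here, so the version with multiplicities
  is used.\<close>

lemma quot_spectral_det_eq:
  "quot_spectral_det Phi p q t = rel_det (model_verts (q + p + 1)) (model_edges (q + p + 1)) t"
proof -
  let ?n = "q + p"
  have n: "?n \<ge> q + p" "?n + 1 \<ge> q + p" by auto
  have "rel_det (model_verts (?n + 1)) (model_edges (?n + 1)) t =
      sdet (model_verts ?n) (\<lambda>x y. (if x = y then 1 else 0) -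
        t * of_nat (card {v \<in> model_edges (?n + 1) `` {x}. fold_pair ?n v = y}))"
  proof (rule rel_det_merge_multi)
    show "finite (model_verts (?n + 1))" by (rule finite_model_verts)
    show "model_verts ?n \<subseteq> model_verts (?n + 1)" by (auto simp: model_verts_def)
    show "model_edges (?n + 1) \<subseteq> model_verts (?n + 1) \<times> model_verts (?n + 1)"
      by (rule model_edges_subset[OF n(2)])
  qed (use fold_pair_range[OF n(1)] model_edges_fold_pair[OF n(1)] in auto)
  also have "\<dots> = sdet (model_verts ?n) (\<lambda>x y. (if pair_class x = pair_class y then 1 else 0) -
      t * of_nat (quot_adj Phi (pair_class x) (pair_class y)))"
  proof (rule sdet_cong)
    fix x y assume xy: "x \<in> model_verts ?n" "y \<in> model_verts ?n"
    obtain i j where ij: "x = sorted_pair i j" "1 \<le> i" "1 \<le> j" "i \<le> ?n" "j \<le> ?n"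
      using xy(1) by (rule model_vertsE)
    have "card {v \<in> model_edges (?n + 1) `` {x}. fold_pair ?n v = y} = quot_adj Phi (pair_class x) (pair_class y)"
      using ij by (simp only: card_model_nbrs quot_adj_pair_class[OF _ _ _ _ xy(2)]
         model_edges_Image trans_le_add1)
    moreover have "pair_class x = pair_class y \<longleftrightarrow> x = y"
      using pair_class_bij xy by (auto simp: bij_betw_def inj_on_def)
    ultimately show "(if x = y then 1 else 0) -
        t * of_nat (card {v \<in> model_edges (?n + 1) `` {x}. fold_pair ?n v = y}) =
        (if pair_class x = pair_class y then 1 else 0) - t * of_nat (quot_adj Phi (pair_class x) (pair_class y))" by simp
  qed
  also have "\<dots> = sdet (quot_verts p q) (\<lambda>X Y. (if X = Y then 1 else 0) - t * of_nat (quot_adj Phi X Y))"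
    by (rule sdet_reindex[OF pair_class_bij finite_model_verts, symmetric])
  also have "\<dots> = quot_spectral_det Phi p q t"
    unfolding sdet_def quot_spectral_det_def by (auto intro!: sum.cong prod.cong)
  finally show ?thesis by simp
qed

end

section \<open>Short cycles in large models\<close>

lemma covers_mono: "R \<subseteq> Q \<Longrightarrow> covers R k \<subseteq> covers Q k"
  by (auto simp: covers_def)

lemma covers_pred:
  assumes "(X, \<sigma>) \<in> covers R k" "v \<in> X"
  obtains u where "u \<in> X" "\<sigma> u = v" "(u, v) \<in> R"
proof -
  have "\<sigma> ` X = X" using assms(1) permutes_image by (auto simp: covers_def)
  then obtain u where "u \<in> X" "\<sigma> u = v" using assms(2) by (metis imageE)
  then show thesis using that assms(1) by (auto simp: covers_def)
qed

text \<open>Descending from \<open>c\<close> one step at a time stays in \<open>C\<close>, which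
  therefore contains {1..c}.\<close>

lemma le_card_if_pred_closed:
  fixes C :: "nat set"
  assumes "finite C" and pred: "\<And>c. c \<in> C \<Longrightarrow> 1 < c \<Longrightarrow> c \<le> h \<Longrightarrow> c - 1 \<in> C"
    and "c \<in> C" "c \<le> h"
  shows "c \<le> card C"
proof -
  have mem: "c - m \<in> C" if "m < c" for m
    using that
  proof (induction m)
    case (Suc m)
    then show ?case using pred[of "c - m"] \<open>c \<le> h\<close> by simp
  qed (use assms in simp)
  have "{1..c} \<subseteq> C"
  proof
    fix d assume "d \<in> {1..c}"
    then show "d \<in> C" using mem[of "c - d"] by simp
  qed
  then show ?thesis using card_mono[OF \<open>finite C\<close>, of "{1..c}"] by simp
qed

text \<open>Every vertex of a cover has a predecessor in the cover, so the coordinates up to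
  \<open>h\<close> that occur are closed under descending to 1; and \<open>k\<close> vertices carry
  at most 2k coordinates.\<close>

lemma coord_bound:
  fixes R :: "((nat \<times> nat) \<times> (nat \<times> nat)) set"
  assumes cov: "(X, \<sigma>) \<in> covers R k"
    and pred: "\<And>u v c. (u, v) \<in> R \<Longrightarrow> c \<in> {fst v, snd v} \<Longrightarrow> 1 < c \<Longrightarrow> c \<le> h \<Longrightarrow>
      c - 1 \<in> {fst u, snd u}"
    and c: "v \<in> X" "c \<in> {fst v, snd v}" "c \<le> h"
  shows "c \<le> 2 * k"
proof -
  let ?C = "fst ` X \<union> snd ` X"
  have X: "finite X" "card X = k" using cov by (auto simp: covers_def)
  have "c \<le> card ?C"
  proof (rule le_card_if_pred_closed[where h = h])
    fix d assume d: "d \<in> ?C" "1 < d" "d \<le> h"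
    then obtain w where w: "w \<in> X" "d \<in> {fst w, snd w}" by auto
    obtain u where u: "u \<in> X" "(u, w) \<in> R" using covers_pred[OF cov w(1)] by metis
    then show "d - 1 \<in> ?C" using pred[OF u(2) w(2) d(2,3)] by auto
  qed (use c X in auto)
  also have "\<dots> \<le> card (fst ` X) + card (snd ` X)" by (rule card_Un_le)
  also have "\<dots> \<le> 2 * k"
    using card_image_le[OF X(1), of fst] card_image_le[OF X(1), of snd] X(2) by simp
  finally show ?thesis .
qed

section \<open>Splitting a large model into three blocks\<close>

context labeled_wedge
begin

definition low_edges :: "nat \<Rightarrow> ((nat \<times> nat) \<times> (nat \<times> nat)) set" where
  "low_edges h = wedge_edges Phi \<inter> model_verts h \<times> model_verts h"

text \<open>On a cycle with exactly one coordinate above \<open>h\<close>, the other coordinate restarts at \<open>1\<close>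
  before it exceeds \<open>q + p\<close>: the labels seen at coordinates beyond \<open>q\<close> repeat with period \<open>p\<close>.
  Hence the bound on \<open>i\<close>.\<close>
definition side_verts :: "nat \<Rightarrow> (nat \<times> nat) set" where
  "side_verts h = {(i, j). 1 \<le> i \<and> i \<le> q + p \<and> h < j \<and> j \<le> h + p}"

text \<open>An S-vertex keeps only the edge that retains the high coordinate: the other one leads to
  low vertices, from which a short cycle cannot return. So at most one edge leaves each
  vertex.\<close>

definition side_edges :: "nat \<Rightarrow> ((nat \<times> nat) \<times> (nat \<times> nat)) set" where
  "side_edges h = {((i, j), w). (i, j) \<in> side_verts h \<and>
      (Phi (i, j) = N \<and> i < q + p \<and> w = (i + 1, wsucc p (h + p) j) \<or>
       Phi (i, j) = S \<and> w = (1, wsucc p (h + p) j))}"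

definition top_verts :: "nat \<Rightarrow> (nat \<times> nat) set" where
  "top_verts h = {(i, j). h < i \<and> i \<le> j \<and> j \<le> h + p}"

text \<open>S-edges are absent because they reset a coordinate to 1 and so leave the block.\<close>

definition top_edges :: "nat \<Rightarrow> ((nat \<times> nat) \<times> (nat \<times> nat)) set" where
  "top_edges h = {((i, j), w). (i, j) \<in> top_verts h \<and>
      Phi (i, j) = N \<and> w = sorted_pair (wsucc p (h + p) i) (wsucc p (h + p) j)}"

lemma wedge_edges_pred:
  assumes "(u, v) \<in> wedge_edges Phi" "c \<in> {fst v, snd v}" "1 < c"
  shows "c - 1 \<in> {fst u, snd u}"
  using assms by (auto simp: wedge_edges_def)

text \<open>In \<Gamma> every coordinate above 1 comes from its predecessor, so
  \<open>coord_bound\<close> applies without an upper limit and keeps a cover of size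
  \<open>k\<close> within coordinates up to 2k.\<close>

lemma covers_wedge_edges:
  assumes "2 * k < h"
  shows "covers (wedge_edges Phi) k = covers (low_edges h) k"
proof (intro equalityI subsetI)
  fix x assume x: "x \<in> covers (wedge_edges Phi) k"
  obtain X \<sigma> where [simp]: "x = (X, \<sigma>)" by (cases x)
  have cov: "(X, \<sigma>) \<in> covers (wedge_edges Phi) k" using x by simp
  have "v \<in> model_verts h" if v: "v \<in> X" for v
  proof -
    have "(v, \<sigma> v) \<in> wedge_edges Phi" using cov v by (auto simp: covers_def)
    then have "v \<in> wedge_dom" by (auto simp: wedge_edges_def)
    moreover have "snd v \<le> 2 * k"
      by (rule coord_bound[OF cov, where h = "snd v" and v = v]) (use wedge_edges_pred v in auto)
    ultimately show ?thesis using assms by (auto simp: wedge_dom_def model_verts_def)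
  qed
  moreover have "\<sigma> v \<in> X" if "v \<in> X" for v
    using that cov permutes_in_image[of \<sigma> X v] by (auto simp: covers_def)
  ultimately show "x \<in> covers (low_edges h) k"
    using cov by (auto simp: covers_def low_edges_def)
qed (use covers_mono[of "low_edges h" "wedge_edges Phi"] in \<open>auto simp: low_edges_def\<close>)

text \<open>Above \<open>h\<close> the successor rotates the p coordinates h + 1, ..., h + p
  cyclically, hence is addition of 1 modulo p.\<close>

lemma wsucc_top:
  assumes "h < i" "i \<le> h + p"
  shows "h < wsucc p (h + p) i" "wsucc p (h + p) i \<le> h + p"
    "(wsucc p (h + p) i + m) mod p = (i + Suc m) mod p"
proof -
  show "h < wsucc p (h + p) i" "wsucc p (h + p) i \<le> h + p"
    using assms p by (auto simp: wsucc_def)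
  show "(wsucc p (h + p) i + m) mod p = (i + Suc m) mod p"
  proof (cases "i < h + p")
    case False
    then have "wsucc p (h + p) i + m + p = i + Suc m" using assms p by (auto simp: wsucc_def)
    then show ?thesis by (metis mod_add_self2)
  qed (simp add: wsucc_def)
qed

lemma model_edgesI:
  assumes "(i, j) \<in> model_verts n"
    and "Phi (i, j) = N \<and> w = sorted_pair (wsucc p n i) (wsucc p n j) \<or>
      Phi (i, j) = S \<and> (w = sorted_pair 1 (wsucc p n i) \<or> w = sorted_pair 1 (wsucc p n j))"
  shows "((i, j), w) \<in> model_edges n"
  using assms by (auto simp: model_edges_def out_nbrs_def model_verts_def sorted_pair_eq_Pair)

lemma model_edgesD:
  assumes "((i, j), w) \<in> model_edges n"
  shows "1 \<le> i" "i \<le> j" "j \<le> n"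
    "Phi (i, j) = N \<and> w = sorted_pair (wsucc p n i) (wsucc p n j) \<or>
     Phi (i, j) = S \<and> (w = sorted_pair 1 (wsucc p n i) \<or> w = sorted_pair 1 (wsucc p n j))"
  using assms by (auto simp: model_edges_def out_nbrs_def model_verts_def sorted_pair_eq_Pair split: wlabel.splits)

lemma blocks_subset_model_edges:
  assumes "q + p \<le> h"
  shows "low_edges h \<union> side_edges h \<union> top_edges h \<subseteq> model_edges (h + p)"
proof (intro Un_least subrelI)
  fix v w assume e: "(v, w) \<in> low_edges h"
  obtain i j where v: "v = (i, j)" by (cases v)
  have "(i, j) \<in> model_verts h" using e by (simp add: low_edges_def v)
  then have ij: "1 \<le> i" "i \<le> j" "j \<le> h" by (auto simp: model_verts_def)
  then have "wsucc p (h + p) i = i + 1" "wsucc p (h + p) j = j + 1"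
    using p by (auto simp: wsucc_def)
  then show "(v, w) \<in> model_edges (h + p)"
    using e ij unfolding v
    by (intro model_edgesI) (auto simp: low_edges_def wedge_edges_def model_verts_def sorted_pair_eq_Pair)
next
  fix v w assume e: "(v, w) \<in> side_edges h"
  obtain i j where v: "v = (i, j)" by (cases v)
  have ij: "1 \<le> i" "i \<le> q + p" "h < j" "j \<le> h + p"
    using e by (auto simp: side_edges_def side_verts_def v)
  have "wsucc p (h + p) i = i + 1" using ij assms by (auto simp: wsucc_def)
  moreover have "h < wsucc p (h + p) j" using wsucc_top ij by simp
  ultimately show "(v, w) \<in> model_edges (h + p)"
    using e ij assms unfolding v
    by (intro model_edgesI) (auto simp: side_edges_def model_verts_def sorted_pair_eq_Pair)
next
  fix v w assume e: "(v, w) \<in> top_edges h"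
  then show "(v, w) \<in> model_edges (h + p)"
    by (cases v) (auto intro!: model_edgesI simp: top_edges_def top_verts_def model_verts_def)
qed

definition tops :: "nat \<Rightarrow> nat \<times> nat \<Rightarrow> nat" where
  "tops h v = of_bool (h < fst v) + of_bool (h < snd v)"

lemma tops_sorted_pair: "tops h (sorted_pair i j) = of_bool (h < i) + of_bool (h < j)"
  by (cases i j rule: sorted_pair_cases) (auto simp: tops_def)

text \<open>Each vertex has only two coordinates and coordinates grow by one along edges unless they are
  reset to \<open>1\<close>, so a cover of size \<open>k\<close> has no coordinate in the gap between \<open>2 * k\<close> and \<open>h\<close>. The
  number of coordinates above the gap cannot increase along an edge, so it is constant on cycles.\<close>
lemma covers_model_edges:
  assumes k: "2 * k < h" and h: "q + p \<le> h"
  shows "covers (model_edges (h + p)) k = covers (low_edges h \<union> side_edges h \<union> top_edges h) k"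
proof (intro equalityI subsetI)
  fix x assume x: "x \<in> covers (model_edges (h + p)) k"
  obtain X \<sigma> where [simp]: "x = (X, \<sigma>)" by (cases x)
  have cov: "(X, \<sigma>) \<in> covers (model_edges (h + p)) k" using x by simp
  have X: "finite X" "\<sigma> permutes X" using cov by (auto simp: covers_def)
  have edge: "(v, \<sigma> v) \<in> model_edges (h + p)" if "v \<in> X" for v
    using cov that by (auto simp: covers_def)
  have \<sigma>X: "\<sigma> v \<in> X" if "v \<in> X" for v using that X(2) by (simp add: permutes_in_image)
  let ?s = "wsucc p (h + p)"
  \<comment> \<open>The only step that is neither addition of 1 nor a reset to 1 goes from h + p to
    h + 1, and c \<le> h excludes it.\<close>
  have pred: "c - 1 \<in> {fst u, snd u}"
    if "(u, v) \<in> model_edges (h + p)" "c \<in> {fst v, snd v}" "1 < c" "c \<le> h" for u v c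
  proof -
    obtain i j where u: "u = (i, j)" by (cases u)
    have "c \<in> {1, ?s i, ?s j}"
      using model_edgesD(4)[OF that(1)[unfolded u]] that(2) by (auto simp: sorted_pair_def min_def max_def split: if_splits)
    moreover have "a = c - 1" if "c = ?s a" for a
      using that \<open>c \<le> h\<close> by (auto simp: wsucc_def split: if_splits)
    ultimately show ?thesis using \<open>1 < c\<close> by (auto simp: u)
  qed
  have bound: "c \<le> 2 * k" if "v \<in> X" "c \<in> {fst v, snd v}" "c \<le> h" for v c
    by (rule coord_bound[OF cov pred that])
  \<comment> \<open>From below, only h itself could step above h, and h lies in the gap because 2k <
    h.\<close>
  have s_gt: "h < i" if "(i, j) \<in> X \<or> (j, i) \<in> X" "h < ?s i" for i j
  proof (rule ccontr)
    assume "\<not> h < i"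
    moreover from this have "i \<le> 2 * k" using bound[of "(i, j)" i] bound[of "(j, i)" i] that(1) by auto
    ultimately show False using that(2) k p by (auto simp: wsucc_def)
  qed
  have tops_le: "tops h (\<sigma> v) \<le> tops h v" if v: "v \<in> X" for v
  proof -
    obtain i j where ij: "v = (i, j)" by (cases v)
    have "h < ?s i \<Longrightarrow> h < i" "h < ?s j \<Longrightarrow> h < j" using s_gt v ij by blast+
    then show ?thesis
      using model_edgesD(4)[OF edge[OF v, unfolded ij]] h p
      by (auto simp: ij tops_sorted_pair) (auto simp: tops_def)
  qed
  have tops_eq: "tops h (\<sigma> v) = tops h v" if v: "v \<in> X" for v
  proof (rule ccontr)
    assume "tops h (\<sigma> v) \<noteq> tops h v"
    then have "tops h (\<sigma> v) < tops h v" using tops_le[OF v] by simp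
    \<comment> \<open>Since \<sigma> permutes \<open>X\<close>, the total number of high coordinates
      is unchanged, so no single vertex can lose one.\<close>
    then have "(\<Sum>v\<in>X. tops h (\<sigma> v)) < (\<Sum>v\<in>X. tops h v)"
      using v tops_le by (intro sum_strict_mono_ex1[OF X(1)]) auto
    moreover have "(\<Sum>v\<in>X. tops h (\<sigma> v)) = (\<Sum>v\<in>X. tops h v)"
      using sum.permute[OF X(2), of "tops h"] by (simp add: comp_def)
    ultimately show False by simp
  qed
  have side: "Phi (i, j) = N \<and> \<sigma> (i, j) = (i + 1, ?s j) \<and> i + 1 \<le> h \<and> h < ?s j \<or>
      Phi (i, j) = S \<and> \<sigma> (i, j) = (1, ?s j) \<and> h < ?s j"
    if v: "(i, j) \<in> X" "i \<le> h" "h < j" for i j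
  proof -
    note D = model_edgesD[OF edge[OF v(1)]]
    have i: "i + 1 \<le> h" "?s i = i + 1" using bound[OF v(1), of i] v(2) k p by (auto simp: wsucc_def)
    have j: "h < ?s j" using wsucc_top(1)[OF v(3) D(3)] .
    have t: "tops h (\<sigma> (i, j)) = 1" using tops_eq[OF v(1)] v by (simp add: tops_def)
    \<comment> \<open>The S-edge that forgets \<open>j\<close> would drop the only high
      coordinate.\<close>
    have "\<sigma> (i, j) \<noteq> sorted_pair 1 (?s i)"
    proof
      assume "\<sigma> (i, j) = sorted_pair 1 (?s i)"
      then show False using t i by (simp add: tops_sorted_pair)
    qed
    then show ?thesis using D(4) i j by (auto simp: sorted_pair_eq_Pair)
  qed
  have small: "i \<le> q + p" if v: "(i, j) \<in> X" "i \<le> h" "h < j" for i j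
  proof (rule ccontr)
    assume "\<not> i \<le> q + p"
    \<comment> \<open>Take the largest low coordinate \<open>a\<close> above q + p. By maximality
      its vertex must carry S, since N would lead on to a + 1.\<close>
    define Y where "Y = {v \<in> X. fst v \<le> h \<and> h < snd v \<and> q + p < fst v}"
    have "finite Y" "(i, j) \<in> Y" using X(1) v \<open>\<not> i \<le> q + p\<close> by (auto simp: Y_def)
    then have "Max (fst ` Y) \<in> fst ` Y" by (intro Max_in) auto
    then obtain a b where ab: "(a, b) \<in> Y" "a = Max (fst ` Y)" by force
    have max: "c \<le> a" if "(c, d) \<in> Y" for c d
      unfolding ab(2) using \<open>finite Y\<close> that by (intro Max_ge) force+
    have ab': "(a, b) \<in> X" "a \<le> h" "h < b" "q + p < a" using ab(1) by (auto simp: Y_def)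
    have lab_ab: "Phi (a, b) = S"
    proof (rule ccontr)
      assume "Phi (a, b) \<noteq> S"
      then have "(a + 1, ?s b) \<in> X" "a + 1 \<le> h" "h < ?s b"
        using side[OF ab'(1,2,3)] \<sigma>X[OF ab'(1)] by auto
      then have "(a + 1, ?s b) \<in> Y" using ab'(4) by (simp add: Y_def)
      then show False using max by fastforce
    qed
    \<comment> \<open>Walk backwards along the cover. For fewer than p steps the low coordinate
      stays above 1, so it was reached along an N-edge, while the high coordinate moves down by 1
      modulo p at each step.\<close>
    have trace: "\<exists>d. (a - m, d) \<in> X \<and> h < d \<and> (d + m) mod p = b mod p \<and> (m > 0 \<longrightarrow> Phi (a - m, d) = N)"
      if "m \<le> p" for m
      using that
    proof (induction m)
      case 0
      then show ?case using ab' by auto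
    next
      case (Suc m)
      then obtain d where d: "(a - m, d) \<in> X" "h < d" "(d + m) mod p = b mod p" by auto
      obtain u where u: "u \<in> X" "\<sigma> u = (a - m, d)" using covers_pred[OF cov d(1)] by metis
      obtain e f where ef: "u = (e, f)" by (cases u)
      have "e \<le> f" "f \<le> h + p" using model_edgesD[OF edge[OF u(1)[unfolded ef]]] by auto
      have "\<not> h < a - m" using ab'(2) by simp
      then have "tops h (e, f) = 1"
        using tops_eq[OF u(1)] u(2) ef d(2) by (simp add: tops_def)
      with \<open>e \<le> f\<close> have "e \<le> h \<and> h < f"
        by (cases "h < e"; cases "h < f") (auto simp: tops_def)
      then have ef': "e \<le> h" "h < f" by blast+
      have "a - m \<noteq> 1" using ab'(4) Suc.prems by simp
      then have "Phi (e, f) = N" "a - m = e + 1" "d = ?s f"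
        using side[OF u(1)[unfolded ef] ef'] u(2) ef by auto
      moreover from this have "(f + Suc m) mod p = b mod p"
        using wsucc_top(3)[OF ef'(2) \<open>f \<le> h + p\<close>, of m] d(3) by simp
      moreover have "e = a - Suc m" using \<open>a - m = e + 1\<close> by simp
      ultimately show ?case using u(1) ef ef' by auto
    qed
    obtain d where d: "(a - p, d) \<in> X" "h < d" "d mod p = b mod p" "Phi (a - p, d) = N"
      using trace[of p] p by auto
    \<comment> \<open>After p steps back both coordinates are equivalent to those of (a, b), yet one
      vertex is labelled N and the other S.\<close>
    have "q + 1 \<le> a - p" using ab'(4) by simp
    then have "same (a - p) a" using ab'(4) le_mod_geq[of p a] by (simp add: eqv_pq_def)
    moreover have "same d b" using d(2,3) ab'(3) h p by (auto simp: eqv_pq_def)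
    ultimately have "lab (a - p) d = lab a b"
      using ab' d(2) by (intro lab_cong) auto
    then show False using d ab' lab_ab by (simp add: sorted_pair_eq_Pair)
  qed
  have "(v, \<sigma> v) \<in> low_edges h \<union> side_edges h \<union> top_edges h" if v: "v \<in> X" for v
  proof -
    obtain i j where ij: "v = (i, j)" by (cases v)
    note v' = v[unfolded ij]
    note D = model_edgesD[OF edge[OF v']]
    consider "j \<le> h" | "i \<le> h" "h < j" | "h < i" by linarith
    then show ?thesis
    proof cases
      case 1
      then have "i + 1 \<le> h" "j + 1 \<le> h" using bound[OF v', of j] D(2) k by auto
      then have "?s i = i + 1" "?s j = j + 1" by (auto simp: wsucc_def)
      then have "(v, \<sigma> v) \<in> low_edges h"
        using D \<open>j + 1 \<le> h\<close> unfolding ij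
        by (auto simp: low_edges_def wedge_edges_def wedge_dom_def model_verts_def sorted_pair_eq_Pair)
      then show ?thesis by blast
    next
      case 2
      have "(v, \<sigma> v) \<in> side_edges h"
        using side[OF v' 2] small[OF v' 2] small[of "i + 1" "?s j"] \<sigma>X[OF v'] D(1,3) 2
        by (auto simp: ij side_edges_def side_verts_def)
      then show ?thesis by blast
    next
      case 3
      have "tops h (\<sigma> (i, j)) = 2" using tops_eq[OF v'] 3 D(2) by (simp add: tops_def)
      then have "Phi (i, j) = N" using D(4) h p by (auto simp: tops_sorted_pair of_bool_def split: if_splits)
      then have "(v, \<sigma> v) \<in> top_edges h"
        using D 3 by (auto simp: ij top_edges_def top_verts_def)
      then show ?thesis by blast
    qed
  qed
  then show "x \<in> covers (low_edges h \<union> side_edges h \<union> top_edges h) k"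
    using cov by (auto simp: covers_def)
qed (use covers_mono[OF blocks_subset_model_edges[OF h]] in blast)

section \<open>The two upper blocks and their independence of the height\<close>

lemma finite_side_verts: "finite (side_verts h)"
  by (rule finite_subset[of _ "{..q + p} \<times> {..h + p}"]) (auto simp: side_verts_def)

lemma finite_top_verts: "finite (top_verts h)"
  by (rule finite_subset[of _ "{..h + p} \<times> {..h + p}"]) (auto simp: top_verts_def)

lemma side_edges_subset: "side_edges h \<subseteq> side_verts h \<times> side_verts h"
  using wsucc_top p by (auto simp: side_edges_def side_verts_def)

lemma top_edges_subset: "top_edges h \<subseteq> top_verts h \<times> top_verts h"
proof (rule subrelI)
  fix v w assume e: "(v, w) \<in> top_edges h"
  obtain i j where v: "v = (i, j)" by (cases v)
  have ij: "h < i" "i \<le> j" "j \<le> h + p" "w = sorted_pair (wsucc p (h + p) i) (wsucc p (h + p) j)"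
    using e by (auto simp: v top_edges_def top_verts_def)
  have "w \<in> top_verts h"
    using wsucc_top[of h i] wsucc_top[of h j] ij by (auto simp: top_verts_def sorted_pair_def)
  then show "(v, w) \<in> top_verts h \<times> top_verts h" using ij by (auto simp: v top_verts_def)
qed

lemma single_valued_side_edges: "single_valued (side_edges h)"
  by (auto simp: single_valued_def side_edges_def)

lemma single_valued_top_edges: "single_valued (top_edges h)"
  by (rule single_valuedI) (simp add: top_edges_def split_beta)

lemma wsucc_shift: "h < i \<Longrightarrow> wsucc p (h + c + p) (i + c) = wsucc p (h + p) i + c"
  by (auto simp: wsucc_def)

lemma same_shift:
  assumes "q < i"
  shows "same (i + p * m) i"
  using assms by (auto simp: eqv_pq_def)

text \<open>Adding a multiple of p to the high coordinate changes neither the labels nor the cyclic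
  successor, and the low coordinate is untouched.\<close>

lemma rel_det_side_shift:
  assumes h: "q + p \<le> h"
  shows "rel_det (side_verts (h + p * m)) (side_edges (h + p * m)) t = rel_det (side_verts h) (side_edges h) t"
proof (rule rel_det_reindex[where f = "\<lambda>(i, j). (i, j + p * m)"])
  show "bij_betw (\<lambda>(i, j). (i, j + p * m)) (side_verts h) (side_verts (h + p * m))"
    by (rule bij_betwI[where g = "\<lambda>(i, j). (i, j - p * m)"]) (auto simp: side_verts_def)
  fix x y assume xy: "x \<in> side_verts h" "y \<in> side_verts h"
  obtain i j k l where [simp]: "x = (i, j)" "y = (k, l)" by (cases x, cases y)
  have ij: "1 \<le> i" "i \<le> q + p" "h < j" "j \<le> h + p" using xy by (auto simp: side_verts_def)
  have "lab i (j + p * m) = lab i j"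
    using ij h same_shift[of j m] by (intro lab_cong) (auto simp: eqv_pq_def)
  then have "Phi (i, j + p * m) = Phi (i, j)" using ij h by (simp add: sorted_pair_eq_Pair)
  then show "((\<lambda>(i, j). (i, j + p * m)) x, (\<lambda>(i, j). (i, j + p * m)) y) \<in> side_edges (h + p * m) \<longleftrightarrow>
      (x, y) \<in> side_edges h"
    using ij wsucc_shift[of h j "p * m"] by (auto simp: side_edges_def side_verts_def)
qed (rule finite_side_verts)

lemma rel_det_top_shift:
  assumes h: "q + p \<le> h"
  shows "rel_det (top_verts (h + p * m)) (top_edges (h + p * m)) t = rel_det (top_verts h) (top_edges h) t"
proof (rule rel_det_reindex[where f = "\<lambda>(i, j). (i + p * m, j + p * m)"])
  show "bij_betw (\<lambda>(i, j). (i + p * m, j + p * m)) (top_verts h) (top_verts (h + p * m))"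
    by (rule bij_betwI[where g = "\<lambda>(i, j). (i - p * m, j - p * m)"]) (auto simp: top_verts_def)
  fix x y assume xy: "x \<in> top_verts h" "y \<in> top_verts h"
  obtain i j k l where [simp]: "x = (i, j)" "y = (k, l)" by (cases x, cases y)
  have ij: "h < i" "i \<le> j" "j \<le> h + p" "k \<le> l" using xy by (auto simp: top_verts_def)
  have "lab (i + p * m) (j + p * m) = lab i j"
    using ij h same_shift[of j m] same_shift[of i m] by (intro lab_cong) auto
  then have "Phi (i + p * m, j + p * m) = Phi (i, j)" using ij h by (simp add: sorted_pair_eq_Pair)
  moreover have "(k + p * m, l + p * m) = sorted_pair (a + p * m) (b + p * m) \<longleftrightarrow> (k, l) = sorted_pair a b" for a b
    using ij by (auto simp: sorted_pair_def min_def max_def)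
  ultimately show "((\<lambda>(i, j). (i + p * m, j + p * m)) x, (\<lambda>(i, j). (i + p * m, j + p * m)) y)
      \<in> top_edges (h + p * m) \<longleftrightarrow> (x, y) \<in> top_edges h"
    using ij wsucc_shift[of h j "p * m"] wsucc_shift[of h i "p * m"]
    by (auto simp: top_edges_def top_verts_def)
qed (rule finite_top_verts)

end

section \<open>Comparison of the power series\<close>

lemma cover_coeff_cong: "covers R k = covers Q k \<Longrightarrow> cover_coeff R k = cover_coeff Q k"
  by (simp add: cover_coeff_def)

lemma rel_det_has_fps_expansion:
  assumes "finite V" "R \<subseteq> V \<times> V"
  shows "(\<lambda>t :: complex. rel_det V R t) has_fps_expansion rel_det V R fps_X"
  unfolding rel_det_expand[OF assms]
  by (intro fps_expansion_intros) (auto simp flip: fps_of_int intro!: fps_expansion_intros)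

lemma holomorphic_rel_det:
  assumes "finite V" "R \<subseteq> V \<times> V"
  shows "(\<lambda>t. rel_det V R t) holomorphic_on A"
  unfolding rel_det_expand[OF assms] by (intro holomorphic_intros)

context labeled_wedge
begin

text \<open>This is \<open>Q\<close>, taken at the height q + p to which all heights q + p + p * m
  reduce.\<close>

definition block_det :: "'b :: idom \<Rightarrow> 'b" where
  "block_det t = rel_det (side_verts (q + p)) (side_edges (q + p)) t *
            rel_det (top_verts (q + p)) (top_edges (q + p)) t"

definition model_det :: "'b :: idom \<Rightarrow> 'b" where
  "model_det t = rel_det (model_verts (q + p + 1)) (model_edges (q + p + 1)) t"

text \<open>Coefficients of degree \<open>n\<close> are compared in a model so high that covers of
  size \<open>n\<close> split into the three blocks. The determinant is multiplicative over disjoint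
  blocks, and the low block agrees with \<Gamma> up to degree \<open>n\<close>.\<close>

lemma model_det_fps_X:
  "model_det fps_X = Abs_fps (\<lambda>k. of_int (spectral_coeff (wedge_edges Phi) k) :: complex) * block_det fps_X"
    (is "_ = ?F * _")
proof (rule fps_ext)
  fix n
  \<comment> \<open>The excess over q + p is a multiple of p, as the shift lemmas require; the
    factor 2 * n + 1 forces 2 * n < h, as needed for covers of size up to n.\<close>
  define h where "h = q + p + p * (2 * n + 1)"
  have "2 * n + 1 \<le> p * (2 * n + 1)" using mult_le_mono1[OF p, of "2 * n + 1"] by simp
  then have h: "q + p \<le> h" "2 * n < h" unfolding h_def by linarith+
  let ?L = "rel_det (model_verts h) (low_edges h) fps_X :: complex fps"
  have low: "low_edges h \<subseteq> model_verts h \<times> model_verts h" by (auto simp: low_edges_def)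
  have disj: "model_verts h \<inter> side_verts h = {}" "(model_verts h \<union> side_verts h) \<inter> top_verts h = {}"
    using h(1) by (auto simp: model_verts_def side_verts_def top_verts_def)
  let ?V = "model_verts h \<union> side_verts h \<union> top_verts h"
  let ?R = "low_edges h \<union> side_edges h \<union> top_edges h"
  have fin: "finite ?V" using finite_model_verts finite_side_verts finite_top_verts by simp
  have RV: "?R \<subseteq> ?V \<times> ?V" using low side_edges_subset[of h] top_edges_subset[of h] by blast
  have "model_det fps_X = rel_det (model_verts (h + p)) (model_edges (h + p)) (fps_X :: complex fps)"
    unfolding model_det_def by (rule rel_det_model[symmetric]) (use h p in simp)
  also have "\<dots> $ n = of_int (cover_coeff (model_edges (h + p)) n)"
    using h by (subst rel_det_fps_X[OF finite_model_verts model_edges_subset]) auto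
  also have "cover_coeff (model_edges (h + p)) n = cover_coeff ?R n"
    by (intro cover_coeff_cong covers_model_edges h)
  also have "of_int (cover_coeff ?R n) = rel_det ?V ?R fps_X $ n"
    by (subst rel_det_fps_X[OF fin RV]) simp
  also have "rel_det ?V ?R (fps_X :: complex fps) =
      rel_det (model_verts h \<union> side_verts h) (low_edges h \<union> side_edges h) fps_X *
      rel_det (top_verts h) (top_edges h) fps_X"
  proof (rule rel_det_Un)
    show "finite (model_verts h \<union> side_verts h)" using fin by simp
    show "low_edges h \<union> side_edges h \<subseteq> (model_verts h \<union> side_verts h) \<times> (model_verts h \<union> side_verts h)"
      using low side_edges_subset[of h] by blast
  qed (intro disj finite_top_verts top_edges_subset)+
  also have "rel_det (model_verts h \<union> side_verts h) (low_edges h \<union> side_edges h) fps_X =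
      ?L * rel_det (side_verts h) (side_edges h) fps_X"
    by (intro rel_det_Un disj finite_model_verts finite_side_verts side_edges_subset low)
  also have "\<dots> * rel_det (top_verts h) (top_edges h) fps_X = ?L * block_det fps_X"
    unfolding block_det_def h_def by (simp only: rel_det_side_shift rel_det_top_shift order_refl mult.assoc)
  also have "(?L * block_det fps_X) $ n = (?F * block_det fps_X) $ n"
  proof -
    have "?L $ k = ?F $ k" if "k \<le> n" for k
    proof -
      have "?L $ k = of_int (cover_coeff (low_edges h) k)"
        by (subst rel_det_fps_X[OF finite_model_verts low]) simp
      also have "cover_coeff (low_edges h) k = cover_coeff (wedge_edges Phi) k"
        by (intro cover_coeff_cong covers_wedge_edges[symmetric]) (use that h in simp)
      finally show ?thesis by (simp add: spectral_coeff_eq_cover_coeff)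
    qed
    then show ?thesis unfolding fps_mult_nth by (intro sum.cong) auto
  qed
  finally show "model_det fps_X $ n = (?F * block_det fps_X) $ n" .
qed

lemma block_det_nonzero: "norm t < 1 \<Longrightarrow> block_det (t :: complex) \<noteq> 0"
  unfolding block_det_def
  by (simp add: rel_det_nonzero finite_side_verts finite_top_verts side_edges_subset
      top_edges_subset single_valued_side_edges single_valued_top_edges)

lemma model_det_has_fps_expansion: "(model_det :: complex \<Rightarrow> complex) has_fps_expansion model_det fps_X"
  unfolding model_det_def by (intro rel_det_has_fps_expansion finite_model_verts model_edges_subset) simp

lemma block_det_has_fps_expansion: "(block_det :: complex \<Rightarrow> complex) has_fps_expansion block_det fps_X"
  unfolding block_det_def
  by (intro has_fps_expansion_mult rel_det_has_fps_expansion finite_side_verts finite_top_verts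
      side_edges_subset top_edges_subset)

text \<open>The quotient is holomorphic in the unit disk, and cancelling the series of
  \<open>block_det\<close> identifies its Taylor coefficients with the spectral coefficients. Its
  Taylor series converges on the whole disk, which also settles the convergence of
  \<open>spectral_det\<close>.\<close>

lemma spectral_det_eq:
  assumes t: "norm t < 1"
  shows "spectral_det (wedge_edges Phi) t = model_det t / block_det t"
proof -
  define F where "F = Abs_fps (\<lambda>k. of_int (spectral_coeff (wedge_edges Phi) k) :: complex)"
  define f where "f = (\<lambda>t :: complex. model_det t / block_det t)"
  have holo: "f holomorphic_on ball 0 1"
    unfolding f_def
  proof (intro holomorphic_on_divide)
    show "model_det holomorphic_on ball 0 (1 :: real)" unfolding model_det_def
      by (intro holomorphic_rel_det finite_model_verts model_edges_subset) simp
    show "block_det holomorphic_on ball 0 (1 :: real)" unfolding block_det_def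
      by (intro holomorphic_on_mult holomorphic_rel_det finite_side_verts finite_top_verts
          side_edges_subset top_edges_subset)
  qed (simp add: block_det_nonzero)
  then have f: "f has_fps_expansion fps_expansion f 0"
    by (intro has_fps_expansion_fps_expansion[of "ball 0 1"]) auto
  have "(\<lambda>t. f t * block_det t) has_fps_expansion fps_expansion f 0 * block_det fps_X"
    by (intro has_fps_expansion_mult f block_det_has_fps_expansion)
  also have "?this \<longleftrightarrow> model_det has_fps_expansion fps_expansion f 0 * block_det fps_X"
  proof (rule has_fps_expansion_cong)
    have "eventually (\<lambda>t :: complex. t \<in> ball 0 1) (nhds 0)"
      by (intro eventually_nhds_in_open) auto
    then show "eventually (\<lambda>t. f t * block_det t = model_det t) (nhds 0)"
      by eventually_elim (simp add: f_def block_det_nonzero)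
  qed simp
  finally have "fps_expansion f 0 * block_det fps_X = model_det fps_X"
    using model_det_has_fps_expansion fps_expansion_unique_complex by blast
  also have "\<dots> = F * block_det fps_X" unfolding F_def by (rule model_det_fps_X)
  finally have "fps_expansion f 0 * block_det fps_X = F * block_det fps_X" .
  \<comment> \<open>The constant coefficient is the value at 0, which is nonzero; so this factor can
    be cancelled in the integral domain of power series.\<close>
  moreover have "block_det (fps_X :: complex fps) \<noteq> 0"
  proof
    assume "block_det (fps_X :: complex fps) = 0"
    then have "block_det (0 :: complex) = 0"
      using has_fps_expansion_imp_0_eq_fps_nth_0[OF block_det_has_fps_expansion] by simp
    then show False using block_det_nonzero[of 0] by simp
  qed
  ultimately have "fps_expansion f 0 = F" by simp
  then have coeff: "of_int (spectral_coeff (wedge_edges Phi) n) = (deriv ^^ n) f 0 / fact n" for n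
    by (simp add: F_def fps_expansion_def fps_eq_iff)
  have "(\<lambda>n. (deriv ^^ n) f 0 / fact n * (t - 0) ^ n) sums f t"
    by (rule holomorphic_power_series[OF holo]) (use t in simp)
  then show ?thesis unfolding spectral_det_def coeff f_def by (simp add: sums_iff)
qed

end

theorem theorem5p6:
  fixes Phi :: "nat \<times> nat \<Rightarrow> wlabel" and p q :: nat
  assumes "p \<ge> 1"
    and "periodic_wedge Phi p q"
  shows "{t. norm t < 1 \<and> spectral_det (wedge_edges Phi) t = 0} =
         {t. norm t < 1 \<and> quot_spectral_det Phi p q t = 0}"
proof -
  interpret labeled_wedge Phi p q by unfold_locales fact+
  show ?thesis
    using spectral_det_eq block_det_nonzero by (auto simp: quot_spectral_det_eq model_det_def)
qed

end
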